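(* For every $d \ge 1$ there is a constant $C(d)$, depending only on $d$, such that for every $d\times d$ matrix weight $W$ on $\mathbb{R}$ satisfying the matrix $A_2$ condition and every $f \in L^2(W)$, $$\|f\|_{L^2(W)}^2 \le C(d)\, [W]_{A_2} \left(1+\log [W]_{A_2}\right) \|S_W f\|_{L^2(\mathbb{R},\mathbb{R})}^2, \qquad \text{where } \|S_W f\|_{L^2(\mathbb{R},\mathbb{R})}^2 = \sum_{I \in \mathcal{D}} \left\langle \langle W \rangle_I \widehat{f}(I), \widehat{f}(I) \right\rangle_{\mathbb{C}^d}.$$
   Context: A $d\times d$ matrix weight is a function $W$ on $\mathbb{R}$ with values in the complex $d\times d$ matrices, with locally integrable entries, such that $W(x)$ is positive semidefinite for a.e. $x$. $L^2(W)$ is the space of measurable $f:\mathbb{R}\to\mathbb{C}^d$ with $\|f\|_{L^2(W)}^2 = \int_{\mathbb{R}} \langle W(x)f(x),f(x)\rangle_{\mathbb{C}^d}\,dx<\infty$. For an interval $I$, $\langle W\rangle_I = \frac{1}{|I|}\int_I W(x)\,dx$. $W$ satisfies the matrix $A_2$ condition ($W \in A_2$) if $$[W]_{A_2} = \sup_I \left\| \langle W \rangle_I^{1/2}\langle W^{-1}\rangle_I^{1/2}\right\|^2<\infty,$$ the supremum being over all bounded intervals $I\subset\mathbb{R}$, where $\|\cdot\|$ is the operator norm on $\mathbb{C}^d$ (in particular $W$ is invertible a.e. and $W^{-1}$ is locally integrable). $\mathcal{D}$ is any fixed grid $\mathcal{D}^{\alpha,r}=\{\alpha+rI: I \text{ a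 standard dyadic interval}\}$ with $\alpha\in\mathbb{R}$, $r>0$ (for instance the standard dyadic grid); the constant does not depend on $\alpha, r$. For $I\in\mathcal{D}$ with left half $I_-$ and right half $I_+$, the Haar function is $h_I = |I|^{-1/2}(\mathbf{1}_{I_+}-\mathbf{1}_{I_-})$, and $\widehat{f}(I) = \int_I f(x)h_I(x)\,dx \in \mathbb{C}^d$. The generalized square function is $S_Wf(x)^2 = \mathbb{E}\big(\|W(x)^{1/2}T_\sigma f(x)\|_{\mathbb{C}^d}^2\big)$, where $T_\sigma f = \sum_{I\in\mathcal{D}}\sigma_I \widehat{f}(I)h_I$ and $\mathbb{E}$ is expectation over independent uniformly distributed random signs $\sigma_I\in\{-1,1\}$; its norm is $\|S_W f\|_{L^2(\mathbb{R},\mathbb{R})}^2=\sum_{I \in \mathcal{D}} \langle \langle W \rangle_I \widehat{f}(I), \widehat{f}(I) \rangle_{\mathbb{C}^d}$, and the theorem is to be understood as a statement about this sum. *)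

theory Defs
  imports "HOL-Analysis.Analysis"
begin

definition cinner :: "complex ^ 'n \<Rightarrow> complex ^ 'n \<Rightarrow> complex" where
  "cinner u v = (\<Sum>i\<in>UNIV. u $ i * cnj (v $ i))"

text \<open>Over the complex numbers, a nonnegative quadratic form forces the matrix to be Hermitian.\<close>

definition psd_matrix :: "complex ^ 'n ^ 'n \<Rightarrow> bool" where
  "psd_matrix A \<longleftrightarrow> (\<forall>v. cinner (A *v v) v \<in> \<real>\<^sub>\<ge>\<^sub>0)"

definition psd_sqrt :: "complex ^ 'n ^ 'n \<Rightarrow> complex ^ 'n ^ 'n" where
  "psd_sqrt A = (THE B. psd_matrix B \<and> B ** B = A)"

definition locally_integrable :: "(real \<Rightarrow> complex ^ 'n ^ 'n) \<Rightarrow> bool" where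
  "locally_integrable W \<longleftrightarrow>
     (\<forall>i j a b. set_integrable lebesgue {a..b} (\<lambda>x. W x $ i $ j))"

definition matrix_weight :: "(real \<Rightarrow> complex ^ 'n ^ 'n) \<Rightarrow> bool" where
  "matrix_weight W \<longleftrightarrow> locally_integrable W \<and> (AE x in lebesgue. psd_matrix (W x))"

text \<open>
  Bounded nondegenerate intervals are represented by their endpoints \<open>a < b\<close>; whether the endpoints
  belong to the interval does not affect averages.
\<close>

definition average :: "(real \<Rightarrow> complex ^ 'n ^ 'n) \<Rightarrow> real \<Rightarrow> real \<Rightarrow> complex ^ 'n ^ 'n" where
  "average W a b = (1 / (b - a)) *\<^sub>R (LINT x:{a..b}|lebesgue. W x)"

definition A2_quantity :: "(real \<Rightarrow> complex ^ 'n ^ 'n) \<Rightarrow> real \<Rightarrow> real \<Rightarrow> real" where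
  "A2_quantity W a b =
     (onorm ((*v) (psd_sqrt (average W a b) **
                   psd_sqrt (average (\<lambda>x. matrix_inv (W x)) a b))))\<^sup>2"

definition A2_const :: "(real \<Rightarrow> complex ^ 'n ^ 'n) \<Rightarrow> real" where
  "A2_const W = (SUP (a, b)\<in>{(a, b). a < b}. A2_quantity W a b)"

text \<open>
  Invertibility almost everywhere and local integrability of the inverse are stated explicitly,
  since \<^const>\<open>matrix_inv\<close> and the Bochner integral are total functions.
\<close>

definition matrix_A2 :: "(real \<Rightarrow> complex ^ 'n ^ 'n) \<Rightarrow> bool" where
  "matrix_A2 W \<longleftrightarrow>
     (AE x in lebesgue. invertible (W x)) \<and>
     locally_integrable (\<lambda>x. matrix_inv (W x)) \<and>
     bdd_above ((\<lambda>(a, b). A2_quantity W a b) ` {(a, b). a < b})"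

text \<open>The real part is taken only for typing: the form is real for almost every \<open>x\<close>.\<close>

definition weighted_L2 :: "(real \<Rightarrow> complex ^ 'n ^ 'n) \<Rightarrow> (real \<Rightarrow> complex ^ 'n) set" where
  "weighted_L2 W =
     {f \<in> borel_measurable lebesgue. integrable lebesgue (\<lambda>x. Re (cinner (W x *v f x) (f x)))}"

definition weighted_L2_norm_sq ::
    "(real \<Rightarrow> complex ^ 'n ^ 'n) \<Rightarrow> (real \<Rightarrow> complex ^ 'n) \<Rightarrow> real" where
  "weighted_L2_norm_sq W f = (LINT x|lebesgue. Re (cinner (W x *v f x) (f x)))"

text \<open>The pair \<open>(a, b)\<close> stands for the half-open interval \<open>{a..<b}\<close>.\<close>

definition dyadic_grid :: "real \<Rightarrow> real \<Rightarrow> (real \<times> real) set" where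
  "dyadic_grid \<alpha> r =
     {(\<alpha> + r * (of_int k * 2 powi j), \<alpha> + r * ((of_int k + 1) * 2 powi j)) | j k. True}"

definition haar :: "real \<Rightarrow> real \<Rightarrow> real \<Rightarrow> real" where
  "haar a b x =
     (indicator {(a + b) / 2..<b} x - indicator {a..<(a + b) / 2} x) / sqrt (b - a)"

definition haar_coeff :: "(real \<Rightarrow> complex ^ 'n) \<Rightarrow> real \<Rightarrow> real \<Rightarrow> complex ^ 'n" where
  "haar_coeff f a b = (LINT x:{a..<b}|lebesgue. haar a b x *\<^sub>R f x)"

text \<open>
  The squared norm of the square function, as a sum of nonnegative terms with values in
  \<^typ>\<open>ennreal\<close>, so that a divergent sum is \<open>\<infinity>\<close>.
\<close>

definition square_function_norm_sq ::
    "real \<Rightarrow> real \<Rightarrow> (real \<Rightarrow> complex ^ 'n ^ 'n) \<Rightarrow> (real \<Rightarrow> complex ^ 'n) \<Rightarrow> ennreal" where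
  "square_function_norm_sq \<alpha> r W f =
     (\<Sum>\<^sub>\<infinity>(a, b)\<in>dyadic_grid \<alpha> r.
        ennreal (Re (cinner (average W a b *v haar_coeff f a b) (haar_coeff f a b))))"

end

(*
  The estimate is dualised: the integral of <f, g> over an interval J is expanded in Haar coefficients,
  and the part containing f is estimated by the square function. What remains is the sum of
  <X_I^-1 g^(I), g^(I)>, where X_I and Y_I are the averages of W and W^-1 over I; it has to be at most
  C A (1 + log A) times the integral of <W^-1 g, g>. This is an induction over the dyadic tree with the Bellman function
    B(X, Y, g) = <X^-1 g, g> + 32 d A (1 + log A) <P^-1 g, g>,    P = 2 X - Y^-1 / (1 + M),
  M = (log det X + log det Y) / (d (1 + log A)).
  The second difference of the first summand controls <X^-1 g^(I), g^(I)> up to an error caused by the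
  variation of X, and that error is dominated by the concavity defect of log det X, which the second
  summand pays for; the factor 1 + log A is the range of log det X + log det Y.
  The contribution of the mean of f over J vanishes as J exhausts a half-line, because the A_2 condition
  makes the mass of W^-1 grow geometrically with the generation of J.
*)
theory Submission
  imports Defs
begin

section \<open>Hermitian matrices\<close>

text \<open>Let \<open>D\<close> and \<open>d\<close> be half the differences of \<open>X\<close>
  and \<open>g\<close> over the two halves of I, and \<open>v = X^-1 g\<close>. Convexity of <X^-1
  g, g> controls only \<open>d - D v\<close>, because the optimal vector \<open>v\<close> itself
  moves with \<open>X\<close>. In a basis orthonormal for \<open>X\<close> in which \<open>D\<close>
  is diagonal with entries t_i, the lost part satisfies <X^-1 D v, D v> <= (max t_i^2) <X v, v>,
  while the concavity defect of log det X is the sum of -log(1 - t_i^2). Comparing all directions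
  with this one scalar avoids a matrix logarithm; the price is that log det X + log det Y ranges
  over [0, d log A], whence the factor d. The scalar gain still has to become a multiple of <X^-1 g,
  g>. M at I exceeds the mean of its values on the halves by at least the normalised defect, and P
  grows with M by a multiple of Y^-1. Since Y^-1 >= X / A, this growth is worth a multiple of <X^-1
  g, g> / A, and here the factor A enters.\<close>

lemma inner_eq_Re_cinner: "u \<bullet> v = Re (cinner u v)" for u v :: "complex ^ 'n"
  by (simp add: cinner_def inner_vec_def inner_complex_def)

lemma cinner_add_left: "cinner (u + v) w = cinner u w + cinner v w"
  by (simp add: cinner_def sum.distrib distrib_right)

lemma cinner_add_right: "cinner w (u + v) = cinner w u + cinner w v"
  by (simp add: cinner_def sum.distrib distrib_left)

lemma cinner_diff_left: "cinner (u - v) w = cinner u w - cinner v w"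
  by (simp add: cinner_def sum_subtractf left_diff_distrib)

lemma cinner_smult_left: "cinner (c *s u) v = c * cinner u v"
  by (simp add: cinner_def sum_distrib_left mult.assoc)

lemma cinner_smult_right: "cinner u (c *s v) = cnj c * cinner u v"
  by (simp add: cinner_def sum_distrib_left algebra_simps)

lemma cinner_commute: "cinner u v = cnj (cinner v u)"
  by (simp add: cinner_def mult.commute)

lemma cinner_sum_left: "cinner (sum f S) v = (\<Sum>i\<in>S. cinner (f i) v)"
  by (induction S rule: infinite_finite_induct) (simp_all add: cinner_add_left, simp_all add: cinner_def)

lemma cinner_sum_right: "cinner v (sum f S) = (\<Sum>i\<in>S. cinner v (f i))"
  by (induction S rule: infinite_finite_induct) (simp_all add: cinner_add_right, simp_all add: cinner_def)

lemma scaleR_eq_smult: "c *\<^sub>R v = complex_of_real c *s v" for v :: "complex ^ 'n"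
  by (simp add: vec_eq_iff) (simp add: scaleR_conv_of_real)

lemma cinner_scaleR_left: "cinner (c *\<^sub>R u) v = of_real c * cinner u v"
  by (simp add: scaleR_eq_smult cinner_smult_left)

lemma cinner_scaleR_right: "cinner u (c *\<^sub>R v) = of_real c * cinner u v"
  by (simp add: scaleR_eq_smult cinner_smult_right)

lemma bounded_bilinear_matrix_vector:
  "bounded_bilinear ((*v) :: complex ^ 'n ^ 'm \<Rightarrow> complex ^ 'n \<Rightarrow> complex ^ 'm)"
  unfolding bilinear_conv_bounded_bilinear[symmetric] bilinear_def
  by (auto intro!: linearI simp: matrix_vector_mult_def vec_eq_iff sum.distrib algebra_simps scaleR_sum_right)

lemmas mv_add_left = bounded_bilinear.add_left[OF bounded_bilinear_matrix_vector]
lemmas mv_add_right = bounded_bilinear.add_right[OF bounded_bilinear_matrix_vector]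
lemmas mv_diff_left = bounded_bilinear.diff_left[OF bounded_bilinear_matrix_vector]
lemmas mv_diff_right = bounded_bilinear.diff_right[OF bounded_bilinear_matrix_vector]
lemmas mv_scaleR_left = bounded_bilinear.scaleR_left[OF bounded_bilinear_matrix_vector]
lemmas mv_scaleR_right = bounded_bilinear.scaleR_right[OF bounded_bilinear_matrix_vector]
lemmas mv_sum_right = bounded_bilinear.sum_right[OF bounded_bilinear_matrix_vector]

lemmas mv_linear_simps = mv_add_left mv_add_right mv_diff_left mv_diff_right mv_scaleR_left mv_scaleR_right

definition hermitian :: "complex ^ 'n ^ 'n \<Rightarrow> bool" where
  "hermitian H \<longleftrightarrow> (\<forall>u v. cinner (H *v u) v = cinner u (H *v v))"

definition posdef :: "complex ^ 'n ^ 'n \<Rightarrow> bool" where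
  "posdef X \<longleftrightarrow> hermitian X \<and> (\<forall>v. v \<noteq> 0 \<longrightarrow> 0 < v \<bullet> (X *v v))"

lemma hermitianD: "hermitian H \<Longrightarrow> cinner (H *v u) v = cinner u (H *v v)"
  by (simp add: hermitian_def)

lemma hermitian_inner: "hermitian H \<Longrightarrow> (H *v u) \<bullet> v = u \<bullet> (H *v v)"
  by (simp add: hermitianD inner_eq_Re_cinner)

lemma hermitian_inner_commute: "hermitian H \<Longrightarrow> u \<bullet> (H *v v) = v \<bullet> (H *v u)"
  by (metis hermitian_inner inner_commute)

lemma hermitian_add: "hermitian X \<Longrightarrow> hermitian Y \<Longrightarrow> hermitian (X + Y)"
  by (simp add: hermitian_def mv_add_left cinner_add_left cinner_add_right)

lemma hermitian_scaleR: "hermitian X \<Longrightarrow> hermitian (c *\<^sub>R X)"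
  by (simp add: hermitian_def mv_scaleR_left cinner_scaleR_left cinner_scaleR_right)

lemma hermitian_diff: "hermitian X \<Longrightarrow> hermitian Y \<Longrightarrow> hermitian (X - Y)"
  using hermitian_add[of X "(-1) *\<^sub>R Y"] hermitian_scaleR[of Y "-1"] by simp

lemma hermitian_cinner_self: "hermitian H \<Longrightarrow> cinner (H *v v) v = of_real (v \<bullet> (H *v v))"
proof -
  assume "hermitian H"
  then have "cinner (H *v v) v = cnj (cinner (H *v v) v)"
    by (metis hermitianD cinner_commute)
  then have "Im (cinner (H *v v) v) = 0"
    by (metis Reals_cnj_iff complex_is_Real_iff)
  then show ?thesis
    by (simp add: complex_eq_iff inner_eq_Re_cinner cinner_commute[of v])
qed

text \<open>Multiplying \<open>v\<close> by the imaginary unit turns the imaginary part of the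
  sesquilinear form into a real part, so symmetry for the real inner product suffices. Later
  arguments can therefore work with the real inner product.\<close>

lemma hermitianI:
  assumes "\<And>u v. (H *v u) \<bullet> v = u \<bullet> (H *v v)"
  shows "hermitian H"
  unfolding hermitian_def
proof (intro allI complex_eqI)
  fix u v
  show "Re (cinner (H *v u) v) = Re (cinner u (H *v v))"
    using assms[of u v] by (simp add: inner_eq_Re_cinner)
  show "Im (cinner (H *v u) v) = Im (cinner u (H *v v))"
    using assms[of u "\<i> *s v"]
    by (simp add: inner_eq_Re_cinner vector_smult_assoc cinner_smult_right vector_scalar_commute)
qed

text \<open>Polarisation: the form at \<open>u + \<i> *s v\<close> is real, and its imaginary part
  is the difference of the real parts of the two mixed terms.\<close>

lemma psd_matrix_hermitian:
  assumes "psd_matrix A"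
  shows "hermitian A"
proof (rule hermitianI)
  fix u v
  define s where "s u v = cinner (A *v u) v" for u v
  have r: "Im (s w w) = 0" for w
    using assms by (auto simp: psd_matrix_def s_def complex_nonneg_Reals_iff)
  have "s (u + \<i> *s v) (u + \<i> *s v) = s u u + \<i> * s v u - \<i> * s u v + s v v"
    by (simp add: s_def mv_add_right cinner_add_left cinner_add_right cinner_smult_left
        cinner_smult_right vector_scalar_commute algebra_simps)
  then have "Re (s u v) = Re (s v u)"
    using r[of "u + \<i> *s v"] r[of u] r[of v] by simp
  then show "(A *v u) \<bullet> v = u \<bullet> (A *v v)"
    by (simp add: inner_eq_Re_cinner s_def cinner_commute[of u])
qed

lemma psd_matrix_nonneg: "psd_matrix A \<Longrightarrow> 0 \<le> v \<bullet> (A *v v)"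
  by (simp add: psd_matrix_def inner_eq_Re_cinner cinner_commute[of v] complex_nonneg_Reals_iff)

lemma posdefD: "posdef X \<Longrightarrow> hermitian X" "posdef X \<Longrightarrow> v \<noteq> 0 \<Longrightarrow> 0 < v \<bullet> (X *v v)"
  by (auto simp: posdef_def)

lemma posdef_nonneg: "posdef X \<Longrightarrow> 0 \<le> v \<bullet> (X *v v)"
  by (cases "v = 0") (auto dest: posdefD(2) less_imp_le)

lemma hermitian_mat_1: "hermitian (mat 1)" 
  by (simp add: hermitian_def)

lemma posdef_mat_1: "posdef (mat 1)"
  by (simp add: posdef_def hermitian_mat_1)

lemma posdef_invertible:
  assumes "posdef X"
  shows "invertible X"
proof -
  have "v = 0" if "X *v v = 0" for v
    using posdefD(2)[OF assms, of v] that by (cases "v = 0") auto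
  then show ?thesis
    by (metis invertible_left_inverse matrix_left_invertible_ker)
qed

lemma matrix_inv_apply:
  fixes X :: "complex ^ 'n ^ 'n"
  assumes "invertible X"
  shows "X *v (matrix_inv X *v v) = v" "matrix_inv X *v (X *v v) = v"
proof -
  have "X ** matrix_inv X = mat 1 \<and> matrix_inv X ** X = mat 1"
    unfolding matrix_inv_def
    by (rule someI_ex) (use assms in \<open>auto simp: invertible_def\<close>)
  then show "X *v (matrix_inv X *v v) = v" "matrix_inv X *v (X *v v) = v"
    by (simp_all add: matrix_vector_mul_assoc)
qed

section \<open>Simultaneous diagonalization of two Hermitian forms\<close>

lemma quadratic_nonneg_imp_zero:
  fixes b c :: real
  assumes "\<And>t. 0 \<le> 2 * t * b + t\<^sup>2 * c"
  shows "b = 0"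
proof (rule ccontr)
  assume b: "b \<noteq> 0"
  define k where "k = \<bar>c\<bar> + 1"
  have k: "k > 0" "c < k" by (auto simp: k_def)
  \<comment> \<open>The choice \<open>t = - b / k\<close> with \<open>k > 0\<close> and
    \<open>k > c\<close> makes the quadratic negative whatever the sign of \<open>c\<close>.\<close>
  have "0 \<le> 2 * (- b / k) * b + (- b / k)\<^sup>2 * c"
    by (rule assms)
  also have "(- b / k)\<^sup>2 * c \<le> (- b / k)\<^sup>2 * k"
    using k by (intro mult_left_mono) auto
  also have "2 * (- b / k) * b + (- b / k)\<^sup>2 * k = - (b\<^sup>2 / k)"
    using k by (simp add: field_simps power2_eq_square)
  also have "\<dots> < 0"
    using b k by simp
  finally show False by simp
qed

text \<open>Induction over the finite index set: the next vector maximises the quotient of the forms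
  of \<open>H\<close> and \<open>X\<close> over the unit vectors that are
  \<open>X\<close>-orthogonal to those already chosen. Working relative to \<open>X\<close> serves
  the log-determinants; \<open>X = mat 1\<close> gives the spectral theorem behind the square
  roots.\<close>

lemma simultaneous_diagonalization:
  fixes X H :: "complex ^ 'n ^ 'n"
  assumes X: "posdef X" and H: "hermitian H"
  obtains e :: "'n \<Rightarrow> complex ^ 'n" and l :: "'n \<Rightarrow> real"
  where "\<And>i j. cinner (X *v e i) (e j) = (if i = j then 1 else 0)"
    and "\<And>i. H *v e i = l i *\<^sub>R (X *v e i)"
proof -
  note hX = posdefD(1)[OF X]
  define P where "P S e l \<longleftrightarrow> (\<forall>i\<in>S. \<forall>j\<in>S. cinner (X *v e i) (e j) = (if i = j then 1 else 0)) \<and>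
      (\<forall>i\<in>S. H *v e i = l i *\<^sub>R (X *v e i))"
    for S and e :: "'n \<Rightarrow> complex ^ 'n" and l :: "'n \<Rightarrow> real"
  have "\<exists>e l. P S e l" for S
  proof (induction S rule: finite_induct[OF finite])
    case 1
    show ?case by (simp add: P_def)
  next
    case (2 i S)
    then obtain e l where el: "P S e l" and iS: "i \<notin> S" by auto
    define U where "U = {v. \<forall>k\<in>S. cinner v (X *v e k) = 0}"
    \<comment> \<open>Dimension count: the rows of \<open>A\<close> are the conditions defining
      \<open>U\<close> and row \<open>i\<close> is zero, so \<open>A\<close> is singular and its
      kernel contains a nonzero element of \<open>U\<close>.\<close>
    define A :: "complex ^ 'n ^ 'n" where
      "A = (\<chi> k j. if k \<in> S then cnj ((X *v e k) $ j) else 0)"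
    have A: "(A *v v) $ k = (if k \<in> S then cinner v (X *v e k) else 0)" for v k
      by (simp add: A_def matrix_vector_mult_def cinner_def mult.commute)
    have "row i A = 0"
      using iS by (simp add: A_def row_def vec_eq_iff)
    then have "\<not> invertible A"
      by (simp add: invertible_det_nz det_zero_row)
    then obtain v0 where v0: "v0 \<noteq> 0" "A *v v0 = 0"
      by (metis invertible_left_inverse matrix_left_invertible_ker)
    have "v0 \<in> U"
      unfolding U_def
    proof safe
      fix k assume "k \<in> S"
      then show "cinner v0 (X *v e k) = 0"
        using A[of v0 k] v0(2) by simp
    qed
    have U_scale: "c *\<^sub>R v \<in> U" if "v \<in> U" for c v
      using that by (simp add: U_def cinner_scaleR_left)
    have U_add: "u + v \<in> U" if "u \<in> U" "v \<in> U" for u v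
      using that by (simp add: U_def cinner_add_left)
    define K where "K = sphere 0 1 \<inter> U"
    have "closed U"
    proof -
      have "U = (\<Inter>k\<in>S. {v. cinner v (X *v e k) = 0})" by (auto simp: U_def)
      moreover have "closed {v. cinner v (X *v e k) = 0}" for k
        unfolding cinner_def by (intro closed_Collect_eq continuous_intros)
      ultimately show ?thesis by auto
    qed
    then have "compact K"
      unfolding K_def by (intro compact_Int_closed) auto
    moreover have "(1 / norm v0) *\<^sub>R v0 \<in> K"
      using v0 \<open>v0 \<in> U\<close> by (simp add: K_def U_scale)
    then have "K \<noteq> {}" by auto
    moreover have "continuous_on K (\<lambda>v. (v \<bullet> (H *v v)) / (v \<bullet> (X *v v)))"
    proof (intro continuous_on_divide continuous_on_inner continuous_on_id)
      show "continuous_on K ((*v) H)"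
        by (intro linear_continuous_on bounded_bilinear.bounded_linear_right[OF bounded_bilinear_matrix_vector])
      show "continuous_on K ((*v) X)"
        by (intro linear_continuous_on bounded_bilinear.bounded_linear_right[OF bounded_bilinear_matrix_vector])
      show "\<forall>v\<in>K. v \<bullet> (X *v v) \<noteq> 0"
      proof
        fix v assume "v \<in> K"
        then have "v \<noteq> 0" by (auto simp: K_def)
        then show "v \<bullet> (X *v v) \<noteq> 0" using posdefD(2)[OF X, of v] by simp
      qed
    qed
    ultimately obtain u where u: "u \<in> K" and
      umax: "\<And>v. v \<in> K \<Longrightarrow> (v \<bullet> (H *v v)) / (v \<bullet> (X *v v)) \<le> (u \<bullet> (H *v u)) / (u \<bullet> (X *v u))"
      using continuous_attains_sup[of K] by blast
    have u0: "u \<noteq> 0" and uU: "u \<in> U" using u by (auto simp: K_def)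
    define m where "m = (u \<bullet> (H *v u)) / (u \<bullet> (X *v u))"
    \<comment> \<open>Maximality of \<open>m\<close> makes the form of \<open>G\<close> nonnegative
      on \<open>U\<close> with a zero at \<open>u\<close>. Hence \<open>G *v u\<close> is orthogonal
      to \<open>U\<close>; being orthogonal to the earlier \<open>e k\<close> as well, it
      vanishes.\<close>
    define G where "G = m *\<^sub>R X - H"
    have hG: "hermitian G" unfolding G_def by (intro hermitian_diff hermitian_scaleR hX H)
    have Gv: "G *v v = m *\<^sub>R (X *v v) - H *v v" for v
      by (simp add: G_def mv_linear_simps)
    have Gpos: "0 \<le> v \<bullet> (G *v v)" if "v \<in> U" for v
    proof (cases "v = 0")
      case False
      define w where "w = (1 / norm v) *\<^sub>R v"
      have "w \<in> K" using False that by (simp add: w_def K_def U_scale)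
      then have "(w \<bullet> (H *v w)) / (w \<bullet> (X *v w)) \<le> m"
        unfolding m_def by (rule umax)
      moreover have "0 < w \<bullet> (X *v w)"
        by (rule posdefD(2)[OF X]) (use False in \<open>simp add: w_def\<close>)
      ultimately have "0 \<le> w \<bullet> (G *v w)"
        by (simp add: Gv inner_diff_right field_simps)
      also have "w \<bullet> (G *v w) = (v \<bullet> (G *v v)) / (norm v)\<^sup>2"
        by (simp add: w_def mv_scaleR_right power2_eq_square)
      finally show ?thesis using False by (simp add: zero_le_divide_iff)
    qed simp
    have Gu0: "u \<bullet> (G *v u) = 0"
      using posdefD(2)[OF X u0] by (simp add: Gv inner_diff_right m_def)
    have GuU: "w \<bullet> (G *v u) = 0" if w: "w \<in> U" for w
    proof (rule quadratic_nonneg_imp_zero)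
      fix t :: real
      have "0 \<le> (u + t *\<^sub>R w) \<bullet> (G *v (u + t *\<^sub>R w))"
        by (intro Gpos U_add U_scale uU w)
      also have "\<dots> = 2 * t * (w \<bullet> (G *v u)) + t\<^sup>2 * (w \<bullet> (G *v w))"
        using hermitian_inner_commute[OF hG, of u w] Gu0
        by (simp add: mv_linear_simps inner_add_left inner_add_right power2_eq_square algebra_simps)
      finally show "0 \<le> 2 * t * (w \<bullet> (G *v u)) + t\<^sup>2 * (w \<bullet> (G *v w))" .
    qed
    have orth: "cinner u (X *v e k) = 0" if "k \<in> S" for k
      using uU that by (simp add: U_def)
    have Gue: "cinner (e k) (G *v u) = 0" if k: "k \<in> S" for k
    proof -
      have "cinner u (G *v e k) = 0"
        using k el orth[OF k]
        by (simp add: Gv P_def scaleR_eq_smult cinner_smult_right cinner_commute[of u "_ - _"]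
            cinner_diff_left cinner_smult_left cinner_commute[of "X *v e k"])
      then show ?thesis
        using hG by (metis hermitianD cinner_commute complex_cnj_zero)
    qed
    have "v \<bullet> (G *v u) = 0" for v
    proof -
      define w where "w = v - (\<Sum>k\<in>S. cinner v (X *v e k) *s e k)"
      have "w \<in> U"
        unfolding U_def
      proof safe
        fix j assume j: "j \<in> S"
        have "(\<Sum>k\<in>S. cinner v (X *v e k) * cinner (e k) (X *v e j))
           = (\<Sum>k\<in>S. if k = j then cinner v (X *v e k) else 0)"
          using el j by (intro sum.cong refl) (auto simp: P_def hermitianD[OF hX, symmetric])
        also have "\<dots> = cinner v (X *v e j)" using j finite by simp
        finally show "cinner w (X *v e j) = 0"
          by (simp add: w_def cinner_diff_left cinner_sum_left cinner_smult_left)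
      qed
      have "v \<bullet> (G *v u) = w \<bullet> (G *v u) + Re (\<Sum>k\<in>S. cinner v (X *v e k) * cinner (e k) (G *v u))"
        by (simp add: w_def inner_eq_Re_cinner cinner_diff_left cinner_sum_left cinner_smult_left)
      also have "\<dots> = 0" using GuU[OF \<open>w \<in> U\<close>] Gue by simp
      finally show ?thesis .
    qed
    from this[of "G *v u"] have "G *v u = 0" by simp
    then have Hu: "H *v u = m *\<^sub>R (X *v u)" by (simp add: Gv)
    define n where "n = sqrt (u \<bullet> (X *v u))"
    have n: "n > 0" "n\<^sup>2 = u \<bullet> (X *v u)"
      using posdefD(2)[OF X u0] by (auto simp: n_def)
    define e' l' where "e' = e(i := (1/n) *\<^sub>R u)" and "l' = l(i := m)"
    have Suu: "cinner (X *v u) u = of_real (n\<^sup>2)"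
      unfolding n by (rule hermitian_cinner_self[OF hX])
    have "P (insert i S) e' l'"
      unfolding P_def
    proof (intro conjI ballI)
      fix a assume "a \<in> insert i S"
      then show "H *v e' a = l' a *\<^sub>R (X *v e' a)"
        using el Hu by (auto simp: P_def e'_def l'_def mv_scaleR_right)
    next
      fix a b assume ab: "a \<in> insert i S" "b \<in> insert i S"
      have o2: "cinner (X *v u) (e k) = 0" if "k \<in> S" for k
        using orth[OF that] by (simp add: hermitianD[OF hX])
      have o3: "cinner (X *v e k) u = 0" if "k \<in> S" for k
        using orth[OF that] cinner_commute[of "X *v e k" u] by simp
      show "cinner (X *v e' a) (e' b) = (if a = b then 1 else 0)"
        using ab el iS n(1) o2 o3 Suu
        by (auto simp: P_def e'_def mv_scaleR_right cinner_scaleR_left cinner_scaleR_right power2_eq_square)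
    qed
    then show ?case by blast
  qed
  from this[of UNIV] show ?thesis
    using that by (auto simp: P_def)
qed

section \<open>Change of basis and determinants\<close>

definition basis_matrix :: "('n \<Rightarrow> complex ^ 'n) \<Rightarrow> complex ^ 'n ^ 'n" where
  "basis_matrix e = (\<chi> a b. e b $ a)"

definition adjoint_basis_matrix :: "('n \<Rightarrow> complex ^ 'n) \<Rightarrow> complex ^ 'n ^ 'n" where
  "adjoint_basis_matrix e = (\<chi> a b. cnj (e a $ b))"

lemma congruence_entry:
  "(adjoint_basis_matrix e ** (M ** basis_matrix e)) $ a $ b = cinner (M *v e b) (e a)"
  by (simp add: matrix_matrix_mult_def matrix_vector_mult_def cinner_def mult.commute
      basis_matrix_def adjoint_basis_matrix_def)

lemma basis_matrix_apply: "basis_matrix e *v y = (\<Sum>i\<in>UNIV. y $ i *s e i)"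
  by (simp add: basis_matrix_def matrix_vector_mult_def vec_eq_iff mult.commute)

lemma adjoint_basis_matrix_apply: "(adjoint_basis_matrix e *v v) $ i = cinner v (e i)"
  by (simp add: adjoint_basis_matrix_def matrix_vector_mult_def cinner_def mult.commute)

lemma orthonormal_congruence:
  fixes X :: "complex ^ 'n ^ 'n" and e :: "'n \<Rightarrow> complex ^ 'n"
  assumes "\<And>i j. cinner (X *v e i) (e j) = (if i = j then 1 else 0)"
  shows "adjoint_basis_matrix e ** (X ** basis_matrix e) = mat 1"
  using assms by (auto simp: vec_eq_iff congruence_entry mat_def)

lemma orthonormal_expansion:
  fixes X :: "complex ^ 'n ^ 'n" and e :: "'n \<Rightarrow> complex ^ 'n"
  assumes X: "hermitian X" and e: "\<And>i j. cinner (X *v e i) (e j) = (if i = j then 1 else 0)"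
  shows "v = (\<Sum>i\<in>UNIV. cinner v (X *v e i) *s e i)"
proof -
  have "basis_matrix e ** (adjoint_basis_matrix e ** X) = mat 1"
    using orthonormal_congruence[OF e] matrix_left_right_inverse matrix_mul_assoc by metis
  then have "v = basis_matrix e *v (adjoint_basis_matrix e *v (X *v v))"
    by (metis matrix_vector_mul_assoc matrix_vector_mul_lid)
  then show ?thesis
    by (simp add: basis_matrix_apply adjoint_basis_matrix_apply hermitianD[OF X])
qed

lemma matrix_eq_on_orthonormal:
  fixes X M N :: "complex ^ 'n ^ 'n" and e :: "'n \<Rightarrow> complex ^ 'n"
  assumes X: "hermitian X" and e: "\<And>i j. cinner (X *v e i) (e j) = (if i = j then 1 else 0)"
    and eq: "\<And>i. M *v e i = N *v e i"
  shows "M = N"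
proof -
  have "M *v v = N *v v" for v
    by (subst (1 2) orthonormal_expansion[OF X e, of v]) (simp add: mv_sum_right vector_scalar_commute eq)
  then show ?thesis by (simp add: matrix_eq)
qed

lemma inner_expansion:
  fixes X M :: "complex ^ 'n ^ 'n" and e :: "'n \<Rightarrow> complex ^ 'n"
  assumes e: "\<And>i j. cinner (X *v e i) (e j) = (if i = j then 1 else 0)"
    and M: "\<And>i. M *v e i = m i *\<^sub>R (X *v e i)"
  shows "(\<Sum>i\<in>UNIV. c i *s e i) \<bullet> (M *v (\<Sum>i\<in>UNIV. c i *s e i)) = (\<Sum>i\<in>UNIV. m i * (cmod (c i))\<^sup>2)"
proof -
  have "cinner (M *v (\<Sum>i\<in>UNIV. c i *s e i)) (\<Sum>i\<in>UNIV. c i *s e i)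
      = (\<Sum>j\<in>UNIV. \<Sum>i\<in>UNIV. if i = j then c i * cnj (c j) * of_real (m i) else 0)"
    unfolding mv_sum_right vector_scalar_commute M cinner_sum_left cinner_sum_right
    by (intro sum.cong refl) (simp add: cinner_smult_left cinner_smult_right cinner_scaleR_left e)
  also have "\<dots> = (\<Sum>j\<in>UNIV. of_real (m j * (cmod (c j))\<^sup>2))"
    by (intro sum.cong refl) (simp add: mult.commute complex_norm_square del: of_real_power)
  finally show ?thesis
    by (simp add: inner_eq_Re_cinner cinner_commute[of "\<Sum>i\<in>UNIV. c i *s e i"] del: of_real_mult of_real_power)
qed

text \<open>In the basis \<open>e\<close> the form \<open>X\<close> becomes the identity and
  \<open>M\<close> becomes diagonal; the first fact eliminates the determinants of the change of
  basis from the second.\<close>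

lemma det_relative_eigenvalues:
  fixes X M :: "complex ^ 'n ^ 'n" and e :: "'n \<Rightarrow> complex ^ 'n"
  assumes e: "\<And>i j. cinner (X *v e i) (e j) = (if i = j then 1 else 0)"
    and M: "\<And>i. M *v e i = m i *\<^sub>R (X *v e i)"
  shows "det M = of_real (\<Prod>i\<in>UNIV. m i) * det X"
proof -
  let ?Z = "basis_matrix e" and ?Y = "adjoint_basis_matrix e"
  have 1: "det ?Y * (det X * det ?Z) = 1"
    using arg_cong[OF orthonormal_congruence[OF e], of det] by (simp add: det_mul)
  have "det (?Y ** (M ** ?Z)) = (\<Prod>i\<in>UNIV. (?Y ** (M ** ?Z)) $ i $ i)"
    by (rule det_diagonal) (simp add: congruence_entry M cinner_scaleR_left e)
  also have "\<dots> = of_real (\<Prod>i\<in>UNIV. m i)"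
    by (simp add: congruence_entry M cinner_scaleR_left e)
  finally have 2: "det ?Y * (det M * det ?Z) = of_real (\<Prod>i\<in>UNIV. m i)"
    by (simp add: det_mul)
  have "det M = det M * (det ?Y * (det X * det ?Z))" by (simp only: 1 mult_1_right)
  also have "\<dots> = (det ?Y * (det M * det ?Z)) * det X" by (simp add: mult_ac)
  finally show ?thesis by (simp only: 2)
qed

lemma relative_eigenvalue:
  assumes e: "cinner (X *v e i) (e i) = 1" and M: "M *v e i = m i *\<^sub>R (X *v e i)"
  shows "e i \<bullet> (M *v e i) = m i"
  using e by (simp add: M inner_eq_Re_cinner cinner_commute[of "e i"] cinner_scaleR_left)

lemma posdef_det:
  fixes X :: "complex ^ 'n ^ 'n"
  assumes "posdef X"
  shows "det X = of_real (Re (det X))" "0 < Re (det X)"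
proof -
  obtain e :: "'n \<Rightarrow> complex ^ 'n" and l where e: "\<And>i j. cinner (mat 1 *v e i) (e j) = (if i = j then 1 else 0)"
    and l: "\<And>i. X *v e i = l i *\<^sub>R (mat 1 *v e i)"
    by (rule simultaneous_diagonalization[OF posdef_mat_1 posdefD(1)[OF assms]]) (rule that)
  have "l i > 0" for i
  proof -
    have "e i \<noteq> 0" using e[of i i] by (auto simp: cinner_def)
    moreover have "e i \<bullet> (X *v e i) = l i"
      by (rule relative_eigenvalue[where X = "mat 1"]) (simp_all only: e l simp_thms if_True)
    ultimately show ?thesis
      using posdefD(2)[OF assms, of "e i"] by simp
  qed
  moreover have "det X = of_real (\<Prod>i\<in>UNIV. l i)"
    using det_relative_eigenvalues[OF e l] by simp
  ultimately show "det X = of_real (Re (det X))" "0 < Re (det X)"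
    by (simp_all add: prod_pos del: of_real_prod)
qed

section \<open>Concavity of the log-determinant\<close>

definition ldet :: "complex ^ 'n ^ 'n \<Rightarrow> real" where
  "ldet X = ln (Re (det X))"

lemma ldet_relative_eigenvalues:
  fixes X M :: "complex ^ 'n ^ 'n" and e :: "'n \<Rightarrow> complex ^ 'n"
  assumes X: "posdef X" and e: "\<And>i j. cinner (X *v e i) (e j) = (if i = j then 1 else 0)"
    and M: "\<And>i. M *v e i = m i *\<^sub>R (X *v e i)" and m: "\<And>i. 0 < m i"
  shows "ldet M = (\<Sum>i\<in>UNIV. ln (m i)) + ldet X"
proof -
  have "Re (det M) = (\<Prod>i\<in>UNIV. m i) * Re (det X)"
    unfolding det_relative_eigenvalues[OF e M] by (simp del: of_real_prod)
  moreover have "0 < (\<Prod>i\<in>UNIV. m i)" by (intro prod_pos) (use m in auto)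
  moreover have "ln (\<Prod>i\<in>UNIV. m i) = (\<Sum>i\<in>UNIV. ln (m i))"
    by (rule ln_prod) (use m in \<open>auto simp: less_imp_neq[symmetric]\<close>)
  ultimately show ?thesis
    using posdef_det(2)[OF X] by (simp only: ldet_def ln_mult_pos)
qed

text \<open>If \<open>t i\<close> are the eigenvalues of \<open>D\<close> relative to
  \<open>X\<close>, the defect of \<open>ldet\<close> is the sum of the terms
  \<open>- ln (1 - (t i)\<^sup>2)\<close>. Each is at least \<open>(t i)\<^sup>2\<close>, so the
  defect bounds every single \<open>(t i)\<^sup>2\<close>. The vector \<open>y\<close> is
  \<open>D v\<close> with \<open>X\<close> inverted, and its coordinates are those of
  \<open>v\<close> multiplied by \<open>t i\<close>.\<close>

lemma ldet_midpoint:
  fixes X D :: "complex ^ 'n ^ 'n"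
  assumes X: "posdef X" and D: "hermitian D" and Xp: "posdef (X + D)" and Xm: "posdef (X - D)"
  obtains y where "X *v y = D *v v"
    and "y \<bullet> (X *v y) \<le> (2 * ldet X - ldet (X + D) - ldet (X - D)) * (v \<bullet> (X *v v))"
proof -
  obtain e :: "'n \<Rightarrow> complex ^ 'n" and t where e: "\<And>i j. cinner (X *v e i) (e j) = (if i = j then 1 else 0)"
    and t: "\<And>i. D *v e i = t i *\<^sub>R (X *v e i)"
    by (rule simultaneous_diagonalization[OF X D]) (rule that)
  have e0: "e i \<noteq> 0" for i using e[of i i] by (auto simp: cinner_def)
  have p: "(X + D) *v e i = (1 + t i) *\<^sub>R (X *v e i)" and m: "(X - D) *v e i = (1 - t i) *\<^sub>R (X *v e i)" for i
    by (simp_all add: mv_linear_simps t algebra_simps)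
  have p0: "0 < 1 + t i" for i
  proof -
    have "e i \<bullet> ((X + D) *v e i) = 1 + t i"
      by (rule relative_eigenvalue[where X = X]) (simp_all only: e p simp_thms if_True)
    then show ?thesis using posdefD(2)[OF Xp e0, of i] by simp
  qed
  have m0: "0 < 1 - t i" for i
  proof -
    have "e i \<bullet> ((X - D) *v e i) = 1 - t i"
      by (rule relative_eigenvalue[where X = X]) (simp_all only: e m simp_thms if_True)
    then show ?thesis using posdefD(2)[OF Xm e0, of i] by simp
  qed
  define a where "a = 2 * ldet X - ldet (X + D) - ldet (X - D)"
  have a_eq: "a = (\<Sum>i\<in>UNIV. - ln (1 - (t i)\<^sup>2))"
  proof -
    have "ln (1 - (t i)\<^sup>2) = ln (1 + t i) + ln (1 - t i)" for i
    proof -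
      have "1 - (t i)\<^sup>2 = (1 + t i) * (1 - t i)" by (simp add: power2_eq_square algebra_simps)
      then show ?thesis using p0 m0 by (simp only: ln_mult_pos)
    qed
    then show ?thesis
      unfolding a_def ldet_relative_eigenvalues[OF X e p p0] ldet_relative_eigenvalues[OF X e m m0]
      by (simp add: sum.distrib sum_negf sum_subtractf)
  qed
  have q: "(t i)\<^sup>2 \<le> - ln (1 - (t i)\<^sup>2)" for i
  proof -
    have "0 < 1 - (t i)\<^sup>2"
      using mult_pos_pos[OF p0 m0, of i i] by (simp add: power2_eq_square algebra_simps)
    from ln_le_minus_one[OF this] show ?thesis by simp
  qed
  have ta: "(t i)\<^sup>2 \<le> a" for i
  proof -
    have "(t i)\<^sup>2 \<le> (\<Sum>i\<in>UNIV. (t i)\<^sup>2)" by (rule member_le_sum) auto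
    also have "\<dots> \<le> (\<Sum>i\<in>UNIV. - ln (1 - (t i)\<^sup>2))" by (rule sum_mono[OF q])
    finally show ?thesis by (simp add: a_eq)
  qed
  define c where "c i = cinner v (X *v e i)" for i
  have v: "v = (\<Sum>i\<in>UNIV. c i *s e i)"
    unfolding c_def by (rule orthonormal_expansion[OF posdefD(1)[OF X] e])
  define y where "y = (\<Sum>i\<in>UNIV. (of_real (t i) * c i) *s e i)"
  have X1: "X *v e i = 1 *\<^sub>R (X *v e i)" for i by simp
  show ?thesis
  proof
    show "X *v y = D *v v"
      by (subst v) (simp add: y_def mv_sum_right vector_scalar_commute t scaleR_eq_smult vector_smult_assoc mult.commute)
    have "y \<bullet> (X *v y) = (\<Sum>i\<in>UNIV. (t i)\<^sup>2 * (cmod (c i))\<^sup>2)"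
      unfolding y_def inner_expansion[OF e X1] by (simp add: norm_mult power_mult_distrib)
    also have "\<dots> \<le> (\<Sum>i\<in>UNIV. a * (cmod (c i))\<^sup>2)"
      by (intro sum_mono mult_right_mono ta) simp
    also have "\<dots> = a * (v \<bullet> (X *v v))"
      by (subst (1 2) v) (simp add: inner_expansion[OF e X1] sum_distrib_left)
    finally show "y \<bullet> (X *v y) \<le> (2 * ldet X - ldet (X + D) - ldet (X - D)) * (v \<bullet> (X *v v))"
      by (simp add: a_def)
  qed
qed

lemma ldet_midpoint_concave:
  assumes "posdef X" "hermitian D" "posdef (X + D)" "posdef (X - D)"
  shows "ldet (X + D) + ldet (X - D) \<le> 2 * ldet (X :: complex ^ 'n ^ 'n)"
proof -
  define v :: "complex ^ 'n" where "v = axis undefined 1"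
  \<comment> \<open>Any nonzero vector serves: its form is positive and can be cancelled from the
    bound.\<close>
  have v: "v \<noteq> 0" by (simp add: v_def axis_eq_0_iff)
  obtain y where "y \<bullet> (X *v y) \<le> (2 * ldet X - ldet (X + D) - ldet (X - D)) * (v \<bullet> (X *v v))"
    using ldet_midpoint[OF assms] by metis
  with posdef_nonneg[OF assms(1), of y]
  have "0 \<le> (2 * ldet X - ldet (X + D) - ldet (X - D)) * (v \<bullet> (X *v v))" by linarith
  then show ?thesis
    using posdefD(2)[OF assms(1) v] by (simp add: zero_le_mult_iff)
qed

text \<open>The two hypotheses are \<open>Y\<^sup>-\<^sup>1 \<le> X\<close> and \<open>X \<le> A Y\<^sup>-\<^sup>1\<close> in a form free of inverses.\<close>

lemma ldet_sum_bounds: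
  fixes X Y :: "complex ^ 'n ^ 'n"
  assumes X: "posdef X" and Y: "posdef Y"
    and lo: "\<And>v w. 2 * (v \<bullet> w) \<le> w \<bullet> (X *v w) + v \<bullet> (Y *v v)"
    and hi: "\<And>y. (Y *v y) \<bullet> (X *v (Y *v y)) \<le> A * (y \<bullet> (Y *v y))"
  shows "1 \<le> A" "0 \<le> ldet X + ldet Y" "ldet X + ldet Y \<le> real CARD('n) * ln A"
proof -
  note hX = posdefD(1)[OF X] and hY = posdefD(1)[OF Y]
  \<comment> \<open>The product of \<open>X\<close> and \<open>Y\<close> is not Hermitian in
    general, but its eigenvalues are those of the Hermitian \<open>Y X Y\<close> relative to
    \<open>Y\<close>. The two hypotheses place them in [1, A].\<close>
  define H where "H = Y ** (X ** Y)"
  have Hv: "H *v v = Y *v (X *v (Y *v v))" for v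
    by (simp add: H_def matrix_vector_mul_assoc matrix_mul_assoc)
  have "hermitian H" unfolding hermitian_def Hv using hermitianD[OF hX] hermitianD[OF hY] by metis
  then obtain e :: "'n \<Rightarrow> complex ^ 'n" and s where e: "\<And>i j. cinner (Y *v e i) (e j) = (if i = j then 1 else 0)"
    and s: "\<And>i. H *v e i = s i *\<^sub>R (Y *v e i)"
    by (rule simultaneous_diagonalization[OF Y]) (rule that)
  have s1: "(Y *v e i) \<bullet> (X *v (Y *v e i)) = s i" for i
    using relative_eigenvalue[of Y e i H s] e s hermitian_inner[OF hY, of "e i"] by (simp add: Hv)
  have y1: "e i \<bullet> (Y *v e i) = 1" for i
    using e[of i i] by (simp add: inner_eq_Re_cinner cinner_commute[of "e i"])
  have sl: "1 \<le> s i" for i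
    using lo[of "e i" "Y *v e i"] s1 y1 by simp
  have su: "s i \<le> A" for i
    using hi[of "e i"] s1 y1 by simp
  show A: "1 \<le> A" using sl[of undefined] su[of undefined] by linarith
  have "ldet H = (\<Sum>i\<in>UNIV. ln (s i)) + ldet Y"
    by (rule ldet_relative_eigenvalues[OF Y e s]) (rule less_le_trans[OF zero_less_one sl])
  moreover have "ldet H = ldet Y + (ldet X + ldet Y)"
  proof -
    have "det H = of_real (Re (det Y) * (Re (det X) * Re (det Y)))"
      using posdef_det(1)[OF X] posdef_det(1)[OF Y] by (metis H_def det_mul of_real_mult)
    then show ?thesis
      using posdef_det(2)[OF X] posdef_det(2)[OF Y] by (simp add: ldet_def ln_mult del: of_real_mult)
  qed
  ultimately have *: "ldet X + ldet Y = (\<Sum>i\<in>UNIV. ln (s i))" by simp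
  show "0 \<le> ldet X + ldet Y"
    unfolding * by (intro sum_nonneg ln_ge_zero sl)
  have "(\<Sum>i\<in>UNIV. ln (s i)) \<le> (\<Sum>i\<in>(UNIV :: 'n set). ln A)"
  proof (rule sum_mono)
    fix i
    show "ln (s i) \<le> ln A" using sl[of i] su[of i] by simp
  qed
  then show "ldet X + ldet Y \<le> real CARD('n) * ln A"
    unfolding * by simp
qed

section \<open>Positive square roots\<close>

lemma psd_sqrt_unique:
  fixes B C :: "complex ^ 'n ^ 'n"
  assumes B: "psd_matrix B" and C: "psd_matrix C" and eq: "B ** B = C ** C"
  shows "B = C"
proof -
  define D where "D = B - C"
  note hB = psd_matrix_hermitian[OF B] and hC = psd_matrix_hermitian[OF C]
  have hD: "hermitian D" unfolding D_def by (intro hermitian_diff hB hC)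
  obtain e :: "'n \<Rightarrow> complex ^ 'n" and l where e: "\<And>i j. cinner (mat 1 *v e i) (e j) = (if i = j then 1 else 0)"
    and l: "\<And>i. D *v e i = l i *\<^sub>R (mat 1 *v e i)"
    by (rule simultaneous_diagonalization[OF posdef_mat_1 hD]) (rule that)
  have "B *v e i = C *v e i" for i
  proof -
    define v where "v = e i"
    have v: "D *v v = l i *\<^sub>R v" using l[of i] by (simp add: v_def)
    have "B *v (B *v v) = C *v (C *v v)" by (simp add: matrix_vector_mul_assoc eq)
    \<comment> \<open>This is \<open>B ** B - C ** C = B ** D + D ** C\<close> at \<open>v\<close>.
      If the eigenvalue is nonzero, the sum of the two nonnegative forms at \<open>v\<close> is
      zero, so both vanish; their difference is the eigenvalue times the squared norm of
      \<open>v\<close>.\<close>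
    then have "B *v (D *v v) + D *v (C *v v) = 0"
      by (simp add: D_def mv_linear_simps)
    then have "v \<bullet> (B *v (D *v v)) + v \<bullet> (D *v (C *v v)) = 0"
      by (metis inner_add_right inner_zero_right)
    then have "l i * (v \<bullet> (B *v v) + v \<bullet> (C *v v)) = 0"
      using hermitian_inner[OF hD, of v "C *v v"]
      by (simp add: v mv_scaleR_right algebra_simps)
    moreover have "v \<bullet> (D *v v) = v \<bullet> (B *v v) - v \<bullet> (C *v v)"
      by (simp add: D_def mv_linear_simps inner_diff_right)
    then have "l i * (v \<bullet> v) = v \<bullet> (B *v v) - v \<bullet> (C *v v)" by (simp add: v)
    ultimately have "l i = 0 \<or> v = 0"
      using psd_matrix_nonneg[OF B, of v] psd_matrix_nonneg[OF C, of v]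
      by (smt (verit) inner_eq_zero_iff mult_eq_0_iff)
    then show ?thesis using v by (auto simp: v_def D_def mv_diff_left)
  qed
  then show ?thesis
    by (rule matrix_eq_on_orthonormal[OF hermitian_mat_1 e])
qed

text \<open>\<open>psd_sqrt\<close> is a definite description, so existence is needed besides
  uniqueness. The witness takes square roots of the eigenvalues in an orthonormal
  eigenbasis.\<close>

lemma psd_sqrt_posdef:
  fixes X :: "complex ^ 'n ^ 'n"
  assumes X: "posdef X"
  shows "psd_matrix (psd_sqrt X)" "psd_sqrt X ** psd_sqrt X = X"
proof -
  obtain e :: "'n \<Rightarrow> complex ^ 'n" and l where e: "\<And>i j. cinner (mat 1 *v e i) (e j) = (if i = j then 1 else 0)"
    and l: "\<And>i. X *v e i = l i *\<^sub>R (mat 1 *v e i)"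
    by (rule simultaneous_diagonalization[OF posdef_mat_1 posdefD(1)[OF X]]) (rule that)
  have l0: "l i \<ge> 0" for i
  proof -
    have "e i \<bullet> (X *v e i) = l i"
      by (rule relative_eigenvalue[where X = "mat 1"]) (simp_all only: e l simp_thms if_True)
    then show ?thesis using posdef_nonneg[OF X, of "e i"] by simp
  qed
  define B :: "complex ^ 'n ^ 'n" where
    "B = (\<chi> a b. \<Sum>i\<in>UNIV. of_real (sqrt (l i)) * e i $ a * cnj (e i $ b))"
  have Bv: "B *v v = (\<Sum>i\<in>UNIV. (of_real (sqrt (l i)) * cinner v (e i)) *s e i)" for v
  proof (simp add: vec_eq_iff, intro allI)
    fix a
    show "(B *v v) $ a = (\<Sum>i\<in>UNIV. of_real (sqrt (l i)) * cinner v (e i) * e i $ a)"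
      unfolding B_def matrix_vector_mult_def cinner_def
      by (simp add: sum_distrib_left sum_distrib_right mult_ac) (rule sum.swap)
  qed
  have Be: "B *v e i = of_real (sqrt (l i)) *s e i" for i
  proof -
    have "B *v e i = (\<Sum>j\<in>UNIV. if j = i then of_real (sqrt (l i)) *s e i else 0)"
      unfolding Bv by (intro sum.cong refl) (use e in auto)
    then show ?thesis by simp
  qed
  have "(B ** B) *v e i = X *v e i" for i
  proof -
    have "(B ** B) *v e i = B *v (B *v e i)" by (simp add: matrix_vector_mul_assoc)
    also have "\<dots> = (of_real (sqrt (l i)) * of_real (sqrt (l i))) *s e i"
      by (simp only: Be vector_scalar_commute vector_smult_assoc)
    also have "\<dots> = of_real (l i) *s e i"
      using l0[of i] by (simp flip: of_real_mult)
    also have "\<dots> = X *v e i" using l[of i] by (simp add: scaleR_eq_smult)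
    finally show ?thesis .
  qed
  then have BB: "B ** B = X"
    by (rule matrix_eq_on_orthonormal[OF hermitian_mat_1 e])
  have "psd_matrix B"
    unfolding psd_matrix_def
  proof
    fix v
    have "cinner (B *v v) v = (\<Sum>i\<in>UNIV. of_real (sqrt (l i) * (cmod (cinner v (e i)))\<^sup>2))"
      unfolding Bv cinner_sum_left cinner_smult_left
      by (intro sum.cong refl)
        (simp add: complex_norm_square mult.assoc cinner_commute[of v] del: of_real_power)
    also have "\<dots> = of_real (\<Sum>i\<in>UNIV. sqrt (l i) * (cmod (cinner v (e i)))\<^sup>2)" by simp
    also have "\<dots> \<in> \<real>\<^sub>\<ge>\<^sub>0"
      unfolding nonneg_Reals_of_real_iff by (intro sum_nonneg mult_nonneg_nonneg) (use l0 in auto)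
    finally show "cinner (B *v v) v \<in> \<real>\<^sub>\<ge>\<^sub>0" .
  qed
  have "\<exists>!B. psd_matrix B \<and> B ** B = X"
  proof (rule ex1I[of _ B])
    fix C assume "psd_matrix C \<and> C ** C = X"
    then show "C = B" using psd_sqrt_unique[of C B] \<open>psd_matrix B\<close> BB by simp
  qed (use \<open>psd_matrix B\<close> BB in simp)
  from theI'[OF this] have "psd_matrix (psd_sqrt X) \<and> psd_sqrt X ** psd_sqrt X = X"
    unfolding psd_sqrt_def .
  then show "psd_matrix (psd_sqrt X)" "psd_sqrt X ** psd_sqrt X = X" by auto
qed

text \<open>With \<open>S\<close> and \<open>R\<close> the square roots of \<open>X\<close> and
  \<open>Y\<close>, the left side is the squared norm of \<open>S ** R\<close> applied to
  \<open>R *v y\<close>, and the form of \<open>Y\<close> at \<open>y\<close> is the squared norm of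
  \<open>R *v y\<close>. Evaluating at \<open>Y *v y\<close> keeps the A_2 bound free of
  inverses.\<close>

lemma onorm_psd_sqrt_product:
  fixes X Y :: "complex ^ 'n ^ 'n"
  assumes X: "posdef X" and Y: "posdef Y"
  shows "(Y *v y) \<bullet> (X *v (Y *v y)) \<le> (onorm ((*v) (psd_sqrt X ** psd_sqrt Y)))\<^sup>2 * (y \<bullet> (Y *v y))"
proof -
  define S R where "S = psd_sqrt X" and "R = psd_sqrt Y"
  have hS: "hermitian S" and SS: "S *v (S *v v) = X *v v"
    and hR: "hermitian R" and RR: "R *v (R *v v) = Y *v v" for v
    using psd_sqrt_posdef[OF X] psd_sqrt_posdef[OF Y]
    by (auto simp: S_def R_def matrix_vector_mul_assoc intro: psd_matrix_hermitian)
  have "norm ((S ** R) *v (R *v y)) \<le> onorm ((*v) (S ** R)) * norm (R *v y)"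
    by (intro onorm bounded_bilinear.bounded_linear_right[OF bounded_bilinear_matrix_vector])
  then have "(norm (S *v (Y *v y)))\<^sup>2 \<le> (onorm ((*v) (S ** R)))\<^sup>2 * (norm (R *v y))\<^sup>2"
    by (metis RR matrix_vector_mul_assoc norm_ge_zero power_mono power_mult_distrib)
  then show ?thesis
    unfolding power2_norm_eq_inner
    by (simp add: hermitian_inner[OF hS] hermitian_inner[OF hR] SS RR flip: S_def R_def)
qed

section \<open>The Bellman function\<close>

definition inv_form :: "complex ^ 'n ^ 'n \<Rightarrow> complex ^ 'n \<Rightarrow> real" where
  "inv_form X g = g \<bullet> (matrix_inv X *v g)"

lemma inv_form_solution:
  assumes "posdef X" "X *v p = g"
  shows "inv_form X g = p \<bullet> (X *v p)"
  using assms by (auto simp: inv_form_def matrix_inv_apply posdef_invertible inner_commute)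

lemma posdef_solution:
  assumes "posdef X"
  obtains p where "X *v p = g" "inv_form X g = p \<bullet> (X *v p)" "inv_form X g = p \<bullet> g"
  using inv_form_solution[OF assms] matrix_inv_apply(1)[OF posdef_invertible[OF assms]] by metis

lemma inv_form_nonneg: "posdef X \<Longrightarrow> 0 \<le> inv_form X g"
  by (metis posdef_solution posdef_nonneg)

text \<open>Completing the square around the solution \<open>p\<close> of \<open>X *v p = g\<close>.
  The left side is affine in \<open>X\<close> and \<open>g\<close>, so convexity and monotonicity of
  \<open>inv_form\<close> reduce to a choice of test vectors \<open>u\<close>.\<close>

lemma inv_form_variational:
  assumes X: "posdef X"
  shows "2 * (u \<bullet> g) - u \<bullet> (X *v u) \<le> inv_form X g"
proof -
  obtain p where p: "X *v p = g" "inv_form X g = p \<bullet> g"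
    using posdef_solution[OF X] by metis
  have "0 \<le> (u - p) \<bullet> (X *v (u - p))" by (rule posdef_nonneg[OF X])
  also have "\<dots> = u \<bullet> (X *v u) - 2 * (u \<bullet> g) + inv_form X g"
    using hermitian_inner_commute[OF posdefD(1)[OF X], of p u] p
    by (simp add: mv_linear_simps inner_diff_left inner_diff_right)
  finally show ?thesis by simp
qed

lemma inv_form_young:
  assumes X: "posdef X" and C: "0 < C"
  shows "u \<bullet> g \<le> C / 2 * (u \<bullet> (X *v u)) + 1 / (2 * C) * inv_form X g"
proof -
  have "2 * (C * (u \<bullet> g)) - C\<^sup>2 * (u \<bullet> (X *v u)) \<le> inv_form X g"
    using inv_form_variational[OF X, of "C *\<^sub>R u" g] by (simp add: mv_scaleR_right power2_eq_square algebra_simps)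
  then have "(2 * (C * (u \<bullet> g)) - C\<^sup>2 * (u \<bullet> (X *v u))) / (2 * C) \<le> inv_form X g / (2 * C)"
    using C by (intro divide_right_mono) auto
  moreover have "(2 * (C * x) - C\<^sup>2 * y) / (2 * C) = x - C / 2 * y" for x y
    using C by (simp add: diff_divide_distrib power2_eq_square)
  ultimately show ?thesis by simp
qed

lemma inv_form_antimono:
  assumes "posdef X" "posdef P" "\<And>u. u \<bullet> (X *v u) \<le> u \<bullet> (P *v u)"
  shows "inv_form P g \<le> inv_form X g"
proof -
  obtain p where p: "inv_form P g = p \<bullet> (P *v p)" "inv_form P g = p \<bullet> g"
    using posdef_solution[OF assms(2)] by metis
  then show ?thesis
    using inv_form_variational[OF assms(1), of p g] assms(3)[of p] by linarith
qed

lemma inv_form_add_le: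
  assumes X: "posdef X"
  shows "inv_form X (a + b) \<le> 2 * inv_form X a + 2 * inv_form X b"
proof -
  obtain p where p: "inv_form X (a + b) = p \<bullet> (X *v p)" "inv_form X (a + b) = p \<bullet> (a + b)"
    using posdef_solution[OF X] by metis
  have "p \<bullet> g - (p \<bullet> (X *v p)) / 4 \<le> inv_form X g" for g
    using inv_form_variational[OF X, of "(1/2) *\<^sub>R p" g] by (simp add: mv_scaleR_right)
  from this[of a] this[of b] p show ?thesis by (simp add: inner_add_right)
qed

lemma hermitian_matrix_inv:
  assumes X: "posdef X"
  shows "hermitian (matrix_inv X)"
  unfolding hermitian_def
proof (intro allI)
  fix u v
  have "cinner (matrix_inv X *v u) (X *v (matrix_inv X *v v)) = cinner (X *v (matrix_inv X *v u)) (matrix_inv X *v v)"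
    by (rule hermitianD[OF posdefD(1)[OF X], symmetric])
  then show "cinner (matrix_inv X *v u) v = cinner u (matrix_inv X *v v)"
    by (simp add: matrix_inv_apply posdef_invertible[OF X])
qed

text \<open>The test vectors are \<open>v + w\<close> for \<open>X + D\<close> and
  \<open>v - w\<close> for \<open>X - D\<close>, where \<open>w\<close> solves
  \<open>X *v w = d - D *v v\<close>: this is the first-order change of the optimal vector when
  \<open>X\<close> and \<open>g\<close> move by \<open>D\<close> and \<open>d\<close>.\<close>

lemma inv_form_midpoint:
  assumes X: "posdef X" and Xp: "posdef (X + D)" and Xm: "posdef (X - D)" and v: "X *v v = g"
  shows "inv_form X g + inv_form X (d - D *v v) \<le> (inv_form (X + D) (g + d) + inv_form (X - D) (g - d)) / 2"
proof -
  have "hermitian (X + D - X)"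
    by (intro hermitian_diff posdefD(1) X Xp)
  then have hD: "hermitian D" by simp
  obtain w where w: "X *v w = d - D *v v" "inv_form X (d - D *v v) = w \<bullet> (X *v w)"
      "inv_form X (d - D *v v) = w \<bullet> (d - D *v v)"
    using posdef_solution[OF X] by metis
  have "2 * ((v + w) \<bullet> (g + d)) - (v + w) \<bullet> ((X + D) *v (v + w)) \<le> inv_form (X + D) (g + d)"
    by (rule inv_form_variational[OF Xp])
  moreover have "2 * ((v - w) \<bullet> (g - d)) - (v - w) \<bullet> ((X - D) *v (v - w)) \<le> inv_form (X - D) (g - d)"
    by (rule inv_form_variational[OF Xm])
  moreover have "inv_form X g = v \<bullet> g" using inv_form_solution[OF X v] v by simp
  ultimately show ?thesis
    using w v hermitian_inner_commute[OF hD, of w v] hermitian_inner_commute[OF posdefD(1)[OF X], of w v]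
    by (simp add: mv_linear_simps inner_add_left inner_add_right inner_diff_left inner_diff_right)
qed

text \<open>The left side is the tangent plane of \<open>1 / (x * y)\<close> at (1, 1). With
  \<open>t = sqrt (x * y)\<close> the inequality of means leaves
  \<open>3 - 2 * t \<le> 1 / t\<^sup>2\<close>, which is
  \<open>0 \<le> (t - 1)\<^sup>2 * (2 * t + 1)\<close>.\<close>

lemma inverse_product_ge:
  fixes x y :: real
  assumes "0 < x" "0 < y"
  shows "3 - x - y \<le> 1 / (x * y)"
proof -
  define t where "t = sqrt (x * y)"
  have t: "0 < t" "t\<^sup>2 = x * y" using assms by (auto simp: t_def)
  have "2 * t \<le> x + y"
    using arith_geo_mean_sqrt[of x y] assms by (simp add: t_def)
  moreover have "0 \<le> (t - 1)\<^sup>2 * (2 * t + 1)" using t by simp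
  then have "3 * t\<^sup>2 \<le> 1 + 2 * t * t\<^sup>2"
    by (simp add: power2_eq_square algebra_simps)
  then have "3 - 2 * t \<le> 1 / t\<^sup>2"
    using t(1) by (simp add: field_simps)
  ultimately show ?thesis using t by simp
qed

text \<open>Joint convexity of \<open>inv_form V u / m\<close> in \<open>(V, m)\<close>, obtained
  from a supporting function at the midpoint. Testing with multiples of the solution
  \<open>z\<close> of \<open>Y *v z = u\<close> leaves scalars, and the tangent plane of
  \<open>1 / (x * y)\<close> makes the lower bound affine in \<open>V\<close> and \<open>m\<close>,
  so the two halves add up exactly.\<close>

lemma inv_form_divide_midpoint:
  assumes Y: "posdef Y" and Yp: "posdef (Y + E)" and Ym: "posdef (Y - E)"
    and m: "0 < m1" "0 < m2"
  shows "2 * (inv_form Y u / ((m1 + m2) / 2)) \<le> inv_form (Y + E) u / m1 + inv_form (Y - E) u / m2"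
proof (cases "u = 0")
  case True
  then show ?thesis by (simp add: inv_form_def)
next
  case False
  define k where "k = (m1 + m2) / 2"
  have k: "k > 0" using m by (simp add: k_def)
  obtain z where z: "Y *v z = u" and p: "inv_form Y u = z \<bullet> (Y *v z)" "inv_form Y u = z \<bullet> u"
    using posdef_solution[OF Y] by metis
  have z0: "z \<noteq> 0" using False z by auto
  define p where "p = inv_form Y u"
  have p_zu: "p = z \<bullet> u" and p_zz: "p = z \<bullet> (Y *v z)" using p by (simp_all add: p_def)
  have p0: "p > 0" unfolding p_def p(1) by (rule posdefD(2)[OF Y z0])
  have *: "p / k * (3 - (z \<bullet> (V *v z)) / p - m / k) \<le> inv_form V u / m"
    if V: "posdef V" and m: "m > 0" for V m
  proof -
    define q where "q = z \<bullet> (V *v z)"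
    have q: "q > 0" unfolding q_def by (rule posdefD(2)[OF V z0])
    \<comment> \<open>Among the multiples \<open>s *\<^sub>R z\<close>, the best test vector has
      \<open>s = p / q\<close>.\<close>
    have "2 * (p / q * p) - (p / q)\<^sup>2 * q \<le> inv_form V u"
    proof -
      have "2 * (s * p) - s\<^sup>2 * q \<le> inv_form V u" for s
        using inv_form_variational[OF V, of "s *\<^sub>R z" u]
        by (simp add: mv_scaleR_right q_def power2_eq_square p_zu mult.assoc)
      then show ?thesis .
    qed
    moreover have "2 * (p / q * p) - (p / q)\<^sup>2 * q = p\<^sup>2 / q"
      using q by (simp add: power2_eq_square)
    ultimately have 1: "p\<^sup>2 / q / m \<le> inv_form V u / m"
      using m by (intro divide_right_mono) auto
    have "p / k * (3 - q / p - m / k) \<le> p / k * (1 / (q / p * (m / k)))"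
      using p0 k q m by (intro mult_left_mono inverse_product_ge) auto
    also have "\<dots> = p\<^sup>2 / q / m"
      using p0 k q m by (simp add: power2_eq_square)
    finally show ?thesis using 1 by (simp add: q_def)
  qed
  have "2 * p / k = p / k * (3 - (z \<bullet> ((Y + E) *v z)) / p - m1 / k) + p / k * (3 - (z \<bullet> ((Y - E) *v z)) / p - m2 / k)"
  proof -
    have "(z \<bullet> ((Y + E) *v z)) / p + (z \<bullet> ((Y - E) *v z)) / p = 2"
    proof -
      have "z \<bullet> ((Y + E) *v z) + z \<bullet> ((Y - E) *v z) = 2 * p"
        by (simp add: p_zz mv_linear_simps inner_add_right inner_diff_right)
      then show ?thesis using p0 by (simp add: add_divide_distrib[symmetric])
    qed
    moreover have "m1 / k + m2 / k = 2"
    proof -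
      have "m1 + m2 = 2 * k" by (simp add: k_def)
      then show ?thesis using k by (simp add: add_divide_distrib[symmetric])
    qed
    ultimately have "(3 - (z \<bullet> ((Y + E) *v z)) / p - m1 / k) + (3 - (z \<bullet> ((Y - E) *v z)) / p - m2 / k) = 2"
      by linarith
    moreover have "p / k * a + p / k * b = p / k * (a + b)" for a b
      by (rule distrib_left[symmetric])
    ultimately show ?thesis by simp
  qed
  also have "\<dots> \<le> inv_form (Y + E) u / m1 + inv_form (Y - E) u / m2"
    by (intro add_mono * Yp Ym m)
  finally show ?thesis by (simp add: p_def k_def)
qed

section \<open>The Bellman function and its midpoint inequality\<close>

definition A2_pair :: "real \<Rightarrow> complex ^ 'n ^ 'n \<Rightarrow> complex ^ 'n ^ 'n \<Rightarrow> bool" where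
  "A2_pair A X Y \<longleftrightarrow> posdef X \<and> posdef Y \<and>
     (\<forall>u. inv_form Y u \<le> u \<bullet> (X *v u) \<and> u \<bullet> (X *v u) \<le> A * inv_form Y u)"

text \<open>
  For averages \<open>X\<close> of \<open>W\<close> and \<open>Y\<close> of \<open>W\<^sup>-\<^sup>1\<close> one has \<open>Y\<^sup>-\<^sup>1 \<le> X \<le> A Y\<^sup>-\<^sup>1\<close>, so \<open>log det X + log det Y\<close> lies
  between \<open>0\<close> and \<open>d log A\<close>; the normalisation with \<open>1 + log A\<close> keeps the ratio in \<open>[0, 1]\<close> and
  avoids dividing by zero when \<open>A = 1\<close>.
\<close>

definition logdet_ratio :: "real \<Rightarrow> complex ^ 'n ^ 'n \<Rightarrow> complex ^ 'n ^ 'n \<Rightarrow> real" where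
  "logdet_ratio A X Y = (ldet X + ldet Y) / (real CARD('n) * (1 + ln A))"

text \<open>
  With the ratio \<open>M\<close> treated as an independent variable, \<open>2 X - Y\<^sup>-\<^sup>1 / (1 + M)\<close> is a concave function
  of \<open>(X, Y, M)\<close>, increasing in \<open>M\<close>, and lies between \<open>X\<close> and \<open>2 X\<close>.
\<close>

definition bellman_matrix :: "real \<Rightarrow> complex ^ 'n ^ 'n \<Rightarrow> complex ^ 'n ^ 'n \<Rightarrow> complex ^ 'n ^ 'n" where
  "bellman_matrix A X Y = 2 *\<^sub>R X - (1 / (1 + logdet_ratio A X Y)) *\<^sub>R matrix_inv Y"

definition bellman :: "real \<Rightarrow> complex ^ 'n ^ 'n \<Rightarrow> complex ^ 'n ^ 'n \<Rightarrow> complex ^ 'n \<Rightarrow> real" where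
  "bellman A X Y g = inv_form X g
     + 32 * real CARD('n) * A * (1 + ln A) * inv_form (bellman_matrix A X Y) g"

lemma A2_pairD:
  assumes "A2_pair A X Y"
  shows "posdef X" "posdef Y" "inv_form Y u \<le> u \<bullet> (X *v u)" "u \<bullet> (X *v u) \<le> A * inv_form Y u"
  using assms by (auto simp: A2_pair_def)

lemma A2_pair_logdet:
  fixes X Y :: "complex ^ 'n ^ 'n"
  assumes "A2_pair A X Y"
  shows "1 \<le> A" "0 \<le> logdet_ratio A X Y" "logdet_ratio A X Y \<le> 1"
proof -
  note X = A2_pairD(1)[OF assms] and Y = A2_pairD(2)[OF assms]
  have lo: "2 * (v \<bullet> w) \<le> w \<bullet> (X *v w) + v \<bullet> (Y *v v)" for v w
    using inv_form_variational[OF Y, of v w] A2_pairD(3)[OF assms, of w] by linarith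
  have hi: "(Y *v y) \<bullet> (X *v (Y *v y)) \<le> A * (y \<bullet> (Y *v y))" for y
    using A2_pairD(4)[OF assms, of "Y *v y"] inv_form_solution[OF Y, of y "Y *v y"] by simp
  note b = ldet_sum_bounds[OF X Y lo hi]
  show A: "1 \<le> A" by (rule b(1))
  have l: "0 \<le> ln A" using A by simp
  have c: "0 < real CARD('n) * (1 + ln A)" using l by (intro mult_pos_pos) auto
  show "0 \<le> logdet_ratio A X Y"
    unfolding logdet_ratio_def using b(2) c by (intro divide_nonneg_pos)
  have "ldet X + ldet Y \<le> real CARD('n) * (1 + ln A)"
    using b(3) by (simp add: distrib_left)
  then show "logdet_ratio A X Y \<le> 1"
    unfolding logdet_ratio_def using c by (simp only: divide_le_eq_1_pos)
qed

lemma bellman_matrix_apply: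
  "u \<bullet> (bellman_matrix A X Y *v u) = 2 * (u \<bullet> (X *v u)) - inv_form Y u / (1 + logdet_ratio A X Y)"
  by (simp add: bellman_matrix_def mv_linear_simps inner_diff_right inv_form_def)

lemma bellman_matrix_bounds:
  assumes "A2_pair A X Y"
  shows "posdef (bellman_matrix A X Y)" "u \<bullet> (X *v u) \<le> u \<bullet> (bellman_matrix A X Y *v u)"
    "u \<bullet> (bellman_matrix A X Y *v u) \<le> 2 * (u \<bullet> (X *v u))"
proof -
  note X = A2_pairD(1)[OF assms] and Y = A2_pairD(2)[OF assms]
  note M = A2_pair_logdet(2)[OF assms]
  have "inv_form Y u / (1 + logdet_ratio A X Y) \<le> inv_form Y u / 1" for u
    using M inv_form_nonneg[OF Y, of u] by (intro divide_left_mono) auto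
  then show lo: "u \<bullet> (X *v u) \<le> u \<bullet> (bellman_matrix A X Y *v u)" for u
    unfolding bellman_matrix_apply using A2_pairD(3)[OF assms, of u] by (smt (verit) div_by_1)
  show "u \<bullet> (bellman_matrix A X Y *v u) \<le> 2 * (u \<bullet> (X *v u))"
    unfolding bellman_matrix_apply using M inv_form_nonneg[OF Y, of u] by simp
  have "hermitian (bellman_matrix A X Y)"
    unfolding bellman_matrix_def
    by (intro hermitian_diff hermitian_scaleR hermitian_matrix_inv[OF Y] posdefD(1)[OF X])
  then show "posdef (bellman_matrix A X Y)"
    unfolding posdef_def using lo posdefD(2)[OF X] less_le_trans by metis
qed

lemma inv_form_bellman_matrix:
  assumes "A2_pair A X Y"
  shows "inv_form (bellman_matrix A X Y) g \<le> inv_form X g"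
    "inv_form X g / 2 \<le> inv_form (bellman_matrix A X Y) g"
proof -
  note X = A2_pairD(1)[OF assms] and P = bellman_matrix_bounds[OF assms]
  show "inv_form (bellman_matrix A X Y) g \<le> inv_form X g"
    by (rule inv_form_antimono[OF X P(1,2)])
  obtain p where p: "inv_form X g = p \<bullet> (X *v p)" "inv_form X g = p \<bullet> g"
    using posdef_solution[OF X] by metis
  have "p \<bullet> g - (p \<bullet> (bellman_matrix A X Y *v p)) / 4 \<le> inv_form (bellman_matrix A X Y) g"
    using inv_form_variational[OF P(1), of "(1/2) *\<^sub>R p" g] by (simp add: mv_scaleR_right)
  then show "inv_form X g / 2 \<le> inv_form (bellman_matrix A X Y) g"
    using P(3)[of p] p by linarith
qed

lemma bellman_bounds:
  fixes X Y :: "complex ^ 'n ^ 'n"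
  assumes "A2_pair A X Y"
  shows "inv_form X g \<le> bellman A X Y g"
    "bellman A X Y g \<le> (1 + 32 * real CARD('n) * A * (1 + ln A)) * inv_form X g"
proof -
  have A: "1 \<le> A" using A2_pair_logdet(1)[OF assms] .
  then have c: "0 \<le> 32 * real CARD('n) * A * (1 + ln A)" by simp
  show "inv_form X g \<le> bellman A X Y g"
    unfolding bellman_def
    using mult_nonneg_nonneg[OF c inv_form_nonneg[OF bellman_matrix_bounds(1)[OF assms], of g]] by simp
  show "bellman A X Y g \<le> (1 + 32 * real CARD('n) * A * (1 + ln A)) * inv_form X g"
    unfolding bellman_def distrib_right
    using mult_left_mono[OF inv_form_bellman_matrix(1)[OF assms, of g] c] by simp
qed

text \<open>All three forms are tested with the vector \<open>u\<close> optimal at the midpoint, so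
  the terms in \<open>D\<close> and \<open>d\<close> cancel. Joint convexity of the subtracted term
  handles the variation of \<open>Y\<close> and of the ratio; what remains is the gain from
  replacing the mean ratio \<open>N\<close> by the larger ratio at the midpoint.\<close>

lemma bellman_matrix_midpoint:
  assumes S: "A2_pair A X Y" and Sp: "A2_pair A (X + D) (Y + E)" and Sm: "A2_pair A (X - D) (Y - E)"
  defines "N \<equiv> (logdet_ratio A (X + D) (Y + E) + logdet_ratio A (X - D) (Y - E)) / 2"
  assumes concave: "N \<le> logdet_ratio A X Y"
  shows "inv_form (bellman_matrix A X Y) g + (logdet_ratio A X Y - N) / (16 * A) * inv_form X g
    \<le> (inv_form (bellman_matrix A (X + D) (Y + E)) (g + d)
        + inv_form (bellman_matrix A (X - D) (Y - E)) (g - d)) / 2"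
proof -
  define M M1 M2 where "M = logdet_ratio A X Y" and "M1 = logdet_ratio A (X + D) (Y + E)"
    and "M2 = logdet_ratio A (X - D) (Y - E)"
  have M: "0 \<le> M" "M \<le> 1" "0 \<le> M1" "0 \<le> M2" "0 \<le> N" "N \<le> M" "N = (M1 + M2) / 2"
    using A2_pair_logdet[OF S] A2_pair_logdet[OF Sp] A2_pair_logdet[OF Sm] concave
    by (auto simp: M_def M1_def M2_def N_def)
  have A: "1 \<le> A" using A2_pair_logdet(1)[OF S] .
  let ?P = "bellman_matrix A X Y" and ?P1 = "bellman_matrix A (X + D) (Y + E)"
    and ?P2 = "bellman_matrix A (X - D) (Y - E)"
  obtain u where u: "inv_form ?P g = u \<bullet> (?P *v u)" "inv_form ?P g = u \<bullet> g"
    using posdef_solution[OF bellman_matrix_bounds(1)[OF S]] by metis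
  define q where "q = inv_form Y u"
  have q0: "0 \<le> q" unfolding q_def by (rule inv_form_nonneg[OF A2_pairD(2)[OF S]])
  have 1: "2 * (u \<bullet> (g + d)) - u \<bullet> (?P1 *v u) \<le> inv_form ?P1 (g + d)"
    by (rule inv_form_variational[OF bellman_matrix_bounds(1)[OF Sp]])
  have 2: "2 * (u \<bullet> (g - d)) - u \<bullet> (?P2 *v u) \<le> inv_form ?P2 (g - d)"
    by (rule inv_form_variational[OF bellman_matrix_bounds(1)[OF Sm]])
  have "2 * (q / (((1 + M1) + (1 + M2)) / 2)) \<le> inv_form (Y + E) u / (1 + M1) + inv_form (Y - E) u / (1 + M2)"
    unfolding q_def using M by (intro inv_form_divide_midpoint A2_pairD(2)[OF S] A2_pairD(2)[OF Sp] A2_pairD(2)[OF Sm]) auto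
  moreover have "((1 + M1) + (1 + M2)) / 2 = 1 + N" using M by simp
  ultimately have 3: "2 * (q / (1 + N)) \<le> inv_form (Y + E) u / (1 + M1) + inv_form (Y - E) u / (1 + M2)"
    by (simp only:)
  have P1: "u \<bullet> (?P1 *v u) = 2 * (u \<bullet> (X *v u)) + 2 * (u \<bullet> (D *v u)) - inv_form (Y + E) u / (1 + M1)"
    by (simp add: bellman_matrix_apply M1_def mv_linear_simps inner_add_right)
  have P2: "u \<bullet> (?P2 *v u) = 2 * (u \<bullet> (X *v u)) - 2 * (u \<bullet> (D *v u)) - inv_form (Y - E) u / (1 + M2)"
    by (simp add: bellman_matrix_apply M2_def mv_linear_simps inner_diff_right)
  have P: "u \<bullet> (?P *v u) = 2 * (u \<bullet> (X *v u)) - q / (1 + M)"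
    by (simp add: bellman_matrix_apply M_def q_def)
  have "inv_form ?P g + (q / (1 + N) - q / (1 + M)) \<le> (inv_form ?P1 (g + d) + inv_form ?P2 (g - d)) / 2"
  proof -
    have arith: "f + (b - c) \<le> (f1 + f2) / 2"
      if "2 * (x + y) - p1 \<le> f1" "2 * (x - y) - p2 \<le> f2" "2 * b \<le> s1 + s2" "p = 2 * w - c"
        "p1 = 2 * w + 2 * e - s1" "p2 = 2 * w - 2 * e - s2" "f = p" "f = x"
      for b c e f f1 f2 p p1 p2 s1 s2 w x y :: real
      using that by simp
    show ?thesis
      by (rule arith[OF 1[unfolded inner_add_right] 2[unfolded inner_diff_right] 3 P P1 P2 u])
  qed
  \<comment> \<open>The factor \<open>16 * A\<close> collects 2 and 2 from comparing the Bellman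
    matrix with twice \<open>X\<close> on two occasions, \<open>A\<close> from the A_2 bound, and 4
    from \<open>(1 + N) * (1 + M) \<le> 4\<close>.\<close>
  moreover have "(M - N) / (16 * A) * inv_form X g \<le> q / (1 + N) - q / (1 + M)"
  proof -
    have "inv_form X g \<le> 2 * inv_form ?P g"
      using inv_form_bellman_matrix(2)[OF S, of g] by simp
    also have "\<dots> \<le> 4 * (u \<bullet> (X *v u))"
      using bellman_matrix_bounds(3)[OF S, of u] u by simp
    also have "\<dots> \<le> 4 * (A * q)"
      using A2_pairD(4)[OF S, of u] by (simp add: q_def)
    finally have "(M - N) / (16 * A) * inv_form X g \<le> (M - N) / (16 * A) * (4 * (A * q))"
      using A M by (intro mult_left_mono) auto
    also have "\<dots> = q * ((M - N) / 4)"
      using A by (simp add: field_simps)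
    also have "\<dots> \<le> q * ((M - N) / ((1 + N) * (1 + M)))"
    proof (intro mult_left_mono divide_left_mono q0)
      show "(1 + N) * (1 + M) \<le> 4"
        using M mult_mono[of "1 + N" 2 "1 + M" 2] by simp
      show "0 < 4 * ((1 + N) * (1 + M))" using M by simp
    qed (use M in auto)
    also have "\<dots> = q / (1 + N) - q / (1 + M)"
    proof -
      have "1 + N \<noteq> 0" "1 + M \<noteq> 0" using M by auto
      then show ?thesis by (simp add: diff_frac_eq algebra_simps)
    qed
    finally show ?thesis .
  qed
  ultimately show ?thesis
    unfolding M_def by (meson add_left_mono order_trans)
qed

text \<open>The vector \<open>d\<close> is split into \<open>d - D *v v\<close> and
  \<open>D *v v\<close>. Convexity of the first summand of \<open>bellman\<close> controls the
  former; the latter costs at most \<open>a * inv_form X g\<close>, which the second summand pays.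
  The factor 2 lost in the splitting is the one half in front of
  \<open>inv_form X d\<close>.\<close>

lemma bellman_step:
  fixes X Y D E :: "complex ^ 'n ^ 'n"
  assumes S: "A2_pair A X Y" and Sp: "A2_pair A (X + D) (Y + E)" and Sm: "A2_pair A (X - D) (Y - E)"
  shows "bellman A X Y g + inv_form X d / 2
    \<le> (bellman A (X + D) (Y + E) (g + d) + bellman A (X - D) (Y - E) (g - d)) / 2"
proof -
  note X = A2_pairD(1)[OF S] and Y = A2_pairD(2)[OF S]
  note Xp = A2_pairD(1)[OF Sp] and Yp = A2_pairD(2)[OF Sp]
  note Xm = A2_pairD(1)[OF Sm] and Ym = A2_pairD(2)[OF Sm]
  have hD: "hermitian D" using hermitian_diff[OF posdefD(1)[OF Xp] posdefD(1)[OF X]] by simp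
  have hE: "hermitian E" using hermitian_diff[OF posdefD(1)[OF Yp] posdefD(1)[OF Y]] by simp
  have A: "1 \<le> A" using A2_pair_logdet(1)[OF S] .
  define c where "c = real CARD('n) * (1 + ln A)"
  have c: "0 < c" using A by (simp add: c_def add_pos_nonneg)
  define a where "a = 2 * ldet X - ldet (X + D) - ldet (X - D)"
  define N where "N = (logdet_ratio A (X + D) (Y + E) + logdet_ratio A (X - D) (Y - E)) / 2"
  \<comment> \<open>Concavity of \<open>ldet\<close> in \<open>Y\<close> can only widen the gap of
    the ratio, so the defect in \<open>X\<close> bounds it from below.\<close>
  have "a / (2 * c) \<le> (2 * (ldet X + ldet Y) - ldet (X + D) - ldet (X - D) - ldet (Y + E) - ldet (Y - E)) / (2 * c)"
    using c ldet_midpoint_concave[OF Y hE Yp Ym] by (intro divide_right_mono) (auto simp: a_def)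
  also have "\<dots> = logdet_ratio A X Y - N"
    unfolding N_def logdet_ratio_def c_def[symmetric] using c by (simp add: field_simps)
  finally have aM: "a / (2 * c) \<le> logdet_ratio A X Y - N" .
  moreover have "0 \<le> a" using ldet_midpoint_concave[OF X hD Xp Xm] by (simp add: a_def)
  ultimately have "N \<le> logdet_ratio A X Y"
    using c by (smt (verit) divide_nonneg_pos)
  note 1 = bellman_matrix_midpoint[OF S Sp Sm this[unfolded N_def], of g d, folded N_def]
  obtain v where v: "X *v v = g" "inv_form X g = v \<bullet> (X *v v)"
    using posdef_solution[OF X] by metis
  note 2 = inv_form_midpoint[OF X Xp Xm v(1), of d]
  obtain y where y: "X *v y = D *v v" "y \<bullet> (X *v y) \<le> a * (v \<bullet> (X *v v))"
    unfolding a_def using ldet_midpoint[OF X hD Xp Xm] by metis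
  have 3: "inv_form X (D *v v) \<le> a * inv_form X g"
    using y inv_form_solution[OF X y(1)] v by simp
  have 4: "inv_form X d \<le> 2 * inv_form X (d - D *v v) + 2 * inv_form X (D *v v)"
    using inv_form_add_le[OF X, of "d - D *v v" "D *v v"] by simp
  \<comment> \<open>This is \<open>(2 * c) * (16 * A)\<close>: the first factor undoes the
    normalisation of the ratio and the averaging of the two halves, the second undoes the loss in
    \<open>bellman_matrix_midpoint\<close>. Hence the coefficient 32 in
    \<open>bellman\<close>.\<close>
  define k where "k = 32 * real CARD('n) * A * (1 + ln A)"
  have k: "k = 32 * A * c" by (simp add: k_def c_def)
  have k0: "0 < k" using A c by (simp add: k)
  have 5: "a * inv_form X g \<le> k * ((logdet_ratio A X Y - N) / (16 * A) * inv_form X g)"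
  proof -
    have "a * inv_form X g = k * (a / (2 * c) / (16 * A) * inv_form X g)"
      using A c by (simp add: k)
    also have "\<dots> \<le> k * ((logdet_ratio A X Y - N) / (16 * A) * inv_form X g)"
      using A k0 by (intro mult_left_mono mult_right_mono divide_right_mono aM inv_form_nonneg[OF X]) auto
    finally show ?thesis .
  qed
  have dist: "k * (x + y) = k * x + k * y" "k * ((x + y) / 2) = (k * x + k * y) / 2" for x y
    by (simp_all add: distrib_left)
  have "k * (inv_form (bellman_matrix A X Y) g + (logdet_ratio A X Y - N) / (16 * A) * inv_form X g)
    \<le> k * ((inv_form (bellman_matrix A (X + D) (Y + E)) (g + d)
        + inv_form (bellman_matrix A (X - D) (Y - E)) (g - d)) / 2)"
    using 1 k0 by (intro mult_left_mono) auto
  note 6 = this[unfolded dist]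
  have arith: "x + p + z / 2 \<le> (x1 + p1 + (x2 + p2)) / 2"
    if "x + r \<le> (x1 + x2) / 2" "s \<le> w" "z \<le> 2 * r + 2 * s" "w \<le> h" "p + h \<le> (p1 + p2) / 2"
    for h p p1 p2 r s w x x1 x2 z :: real
    using that by (simp add: field_simps)
  show ?thesis
    unfolding bellman_def k_def[symmetric] by (rule arith[OF 2 3 4 5 6])
qed

section \<open>Averages of matrix weights\<close>

lemma set_integral_bounded_linear:
  fixes T :: "'b::{banach, second_countable_topology} \<Rightarrow> 'c::{banach, second_countable_topology}"
  assumes T: "bounded_linear T" and f: "set_integrable M S f"
  shows "set_integrable M S (\<lambda>x. T (f x))" "(LINT x:S|M. T (f x)) = T (LINT x:S|M. f x)"
proof -
  have eq: "(\<lambda>x. indicator S x *\<^sub>R T (f x)) = (\<lambda>x. T (indicator S x *\<^sub>R f x))"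
    by (simp add: linear_simps(5)[OF T])
  show "set_integrable M S (\<lambda>x. T (f x))"
    using f unfolding set_integrable_def eq by (rule integrable_bounded_linear[OF T])
  show "(LINT x:S|M. T (f x)) = T (LINT x:S|M. f x)"
    using f unfolding set_integrable_def set_lebesgue_integral_def eq
    by (rule integral_bounded_linear[OF T])
qed

lemma set_integral_combine:
  fixes f :: "real \<Rightarrow> 'a::euclidean_space"
  assumes f: "set_integrable lebesgue {a..b} f" and ab: "a \<le> c" "c \<le> b"
  shows "(LINT x:{a..b}|lebesgue. f x) = (LINT x:{a..c}|lebesgue. f x) + (LINT x:{c..b}|lebesgue. f x)"
proof -
  have 1: "set_integrable lebesgue {a..c} f" "set_integrable lebesgue {c..b} f"
    using ab by (auto intro!: set_integrable_subset[OF f])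
  show ?thesis
    using Henstock_Kurzweil_Integration.integral_combine[OF ab set_lebesgue_integral_eq_integral(1)[OF f]]
    by (simp add: set_lebesgue_integral_eq_integral(2)[OF f]
        set_lebesgue_integral_eq_integral(2)[OF 1(1)] set_lebesgue_integral_eq_integral(2)[OF 1(2)])
qed

lemma set_integral_pos:
  fixes h :: "real \<Rightarrow> real"
  assumes h: "set_integrable lebesgue {a..b} h" and pos: "AE x in lebesgue. 0 < h x" and ab: "a < b"
  shows "0 < (LINT x:{a..b}|lebesgue. h x)"
proof -
  let ?g = "\<lambda>x. indicator {a..b} x *\<^sub>R h x"
  have nn: "AE x in lebesgue. 0 \<le> ?g x"
    using pos by eventually_elim (simp add: indicator_def)
  have int: "integrable lebesgue ?g" using h by (simp add: set_integrable_def)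
  have "integral\<^sup>L lebesgue ?g \<noteq> 0"
  proof
    assume "integral\<^sup>L lebesgue ?g = 0"
    then have "AE x in lebesgue. ?g x = 0"
      using integral_nonneg_eq_0_iff_AE[OF int nn] by simp
    with pos have "AE x in lebesgue. x \<notin> {a..b}"
      by eventually_elim (auto simp: indicator_def)
    then have "{a..b} \<in> null_sets lebesgue"
      by (subst (asm) AE_iff_null_sets[symmetric]) auto
    then show False using ab by (simp add: null_sets_def)
  qed
  moreover have "0 \<le> integral\<^sup>L lebesgue ?g" by (rule integral_nonneg_AE[OF nn])
  ultimately show ?thesis by (simp add: set_lebesgue_integral_def)
qed

lemma set_integral_mono_lebesgue:
  fixes f g :: "real \<Rightarrow> real"
  assumes "set_integrable lebesgue S f" "set_integrable lebesgue S g"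
    and "AE x in lebesgue. x \<in> S \<longrightarrow> f x \<le> g x"
  shows "(LINT x:S|lebesgue. f x) \<le> (LINT x:S|lebesgue. g x)"
  unfolding set_lebesgue_integral_def
proof (rule integral_mono_AE)
  show "AE x in lebesgue. indicator S x *\<^sub>R f x \<le> indicator S x *\<^sub>R g x"
    using assms(3) by eventually_elim (auto simp: indicator_def)
qed (use assms in \<open>auto simp: set_integrable_def\<close>)

lemma locally_integrable_matrix:
  fixes W :: "real \<Rightarrow> complex ^ 'n ^ 'n"
  assumes "locally_integrable W"
  shows "set_integrable lebesgue {a..b} W"
proof (rule absolutely_integrable_componentwise)
  fix e :: "complex ^ 'n ^ 'n" assume "e \<in> Basis"
  then obtain i j u where e: "e = axis i (axis j u)"
    unfolding Basis_vec_def by auto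
  have "set_integrable lebesgue {a..b} (\<lambda>x. W x $ i $ j)"
    using assms by (simp add: locally_integrable_def)
  from set_integral_bounded_linear(1)[OF bounded_linear_inner_left this, of u]
  show "set_integrable lebesgue {a..b} (\<lambda>x. W x \<bullet> e)"
    by (simp add: e inner_axis)
qed

lemma bounded_linear_matrix_form: "bounded_linear (\<lambda>M :: complex ^ 'n ^ 'n. u \<bullet> (M *v v))"
  by (intro bounded_linear_compose[OF bounded_linear_inner_right]
      bounded_bilinear.bounded_linear_left[OF bounded_bilinear_matrix_vector])

lemma set_integrable_matrix_form:
  fixes W :: "real \<Rightarrow> complex ^ 'n ^ 'n"
  assumes "locally_integrable W"
  shows "set_integrable lebesgue {a..b} (\<lambda>x. u \<bullet> (W x *v v))"
  by (rule set_integral_bounded_linear(1)[OF bounded_linear_matrix_form locally_integrable_matrix[OF assms]])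

lemma set_integral_matrix_form:
  fixes W :: "real \<Rightarrow> complex ^ 'n ^ 'n"
  assumes W: "locally_integrable W" and ab: "a < b"
  shows "(LINT x:{a..b}|lebesgue. u \<bullet> (W x *v v)) = (b - a) * (u \<bullet> (average W a b *v v))"
  using ab by (simp add: set_integral_bounded_linear(2)[OF bounded_linear_matrix_form locally_integrable_matrix[OF W]]
      average_def mv_scaleR_left)

lemma average_halves:
  fixes W :: "real \<Rightarrow> complex ^ 'n ^ 'n"
  assumes W: "locally_integrable W" and ab: "a < b"
  shows "average W a b = (1 / 2) *\<^sub>R (average W a ((a + b) / 2) + average W ((a + b) / 2) b)"
proof -
  define m where "m = (a + b) / 2"
  have m: "a < m" "m < b" "m - a = (b - a) / 2" "b - m = (b - a) / 2"
    using ab by (auto simp: m_def field_simps)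
  have "(LINT x:{a..b}|lebesgue. W x) = (LINT x:{a..m}|lebesgue. W x) + (LINT x:{m..b}|lebesgue. W x)"
    using m by (intro set_integral_combine locally_integrable_matrix[OF W]) auto
  then show ?thesis
    unfolding average_def m_def[symmetric] m(3,4) by (simp add: scaleR_add_right)
qed

text \<open>A vector on which a nonnegative form vanishes minimises it, so the first-order condition
  puts the vector in the kernel.\<close>

lemma posdef_of_psd_invertible:
  assumes psd: "psd_matrix X" and inv: "invertible X"
  shows "posdef X"
proof -
  have hX: "hermitian X" by (rule psd_matrix_hermitian[OF psd])
  have "0 < v \<bullet> (X *v v)" if v: "v \<noteq> 0" for v
  proof (rule ccontr)
    assume "\<not> 0 < v \<bullet> (X *v v)"
    then have 0: "v \<bullet> (X *v v) = 0" using psd_matrix_nonneg[OF psd, of v] by simp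
    have "w \<bullet> (X *v v) = 0" for w
    proof (rule quadratic_nonneg_imp_zero)
      fix t
      have "0 \<le> (v + t *\<^sub>R w) \<bullet> (X *v (v + t *\<^sub>R w))" by (rule psd_matrix_nonneg[OF psd])
      also have "\<dots> = 2 * t * (w \<bullet> (X *v v)) + t\<^sup>2 * (w \<bullet> (X *v w))"
        using 0 hermitian_inner_commute[OF hX, of v w]
        by (simp add: mv_linear_simps inner_add_left inner_add_right power2_eq_square algebra_simps)
      finally show "0 \<le> 2 * t * (w \<bullet> (X *v v)) + t\<^sup>2 * (w \<bullet> (X *v w))" .
    qed
    from this[of "X *v v"] have "X *v v = 0" by simp
    then have "v = 0" using matrix_inv_apply(2)[OF inv, of v] by simp
    with v show False by simp
  qed
  with hX show ?thesis by (simp add: posdef_def)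
qed

section \<open>Averages of the weight and of its inverse\<close>

locale A2_weight =
  fixes W :: "real \<Rightarrow> complex ^ 'n ^ 'n"
  assumes weight: "matrix_weight W" and A2: "matrix_A2 W"
begin

definition Winv :: "real \<Rightarrow> complex ^ 'n ^ 'n" where
  "Winv x = matrix_inv (W x)"

definition A :: real where
  "A = A2_const W"

abbreviation X :: "real \<Rightarrow> real \<Rightarrow> complex ^ 'n ^ 'n" where
  "X \<equiv> average W"

abbreviation Y :: "real \<Rightarrow> real \<Rightarrow> complex ^ 'n ^ 'n" where
  "Y \<equiv> average Winv"

lemma Winv_eq: "(\<lambda>x. matrix_inv (W x)) = Winv"
  by (simp add: Winv_def fun_eq_iff)

lemma loc_W: "locally_integrable W"
  using weight by (simp add: matrix_weight_def)

lemma loc_Winv: "locally_integrable Winv"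
  using A2 by (simp add: matrix_A2_def Winv_eq)

lemma AE_posdef: "AE x in lebesgue. posdef (W x)"
proof -
  have "AE x in lebesgue. psd_matrix (W x)" "AE x in lebesgue. invertible (W x)"
    using weight A2 by (auto simp: matrix_weight_def matrix_A2_def)
  then show ?thesis by eventually_elim (rule posdef_of_psd_invertible)
qed

lemma Winv_form: "v \<bullet> (Winv x *v v) = inv_form (W x) v"
  by (simp add: inv_form_def Winv_def)

lemma AE_Winv_pos: "AE x in lebesgue. \<forall>v. v \<noteq> 0 \<longrightarrow> 0 < v \<bullet> (Winv x *v v)"
  using AE_posdef
proof eventually_elim
  case (elim x)
  show ?case
  proof (intro allI impI)
    fix v :: "complex ^ 'n" assume "v \<noteq> 0"
    obtain p where p: "W x *v p = v" "inv_form (W x) v = p \<bullet> (W x *v p)"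
      using posdef_solution[OF elim] by metis
    then have "p \<noteq> 0" using \<open>v \<noteq> 0\<close> by auto
    with posdefD(2)[OF elim this] p show "0 < v \<bullet> (Winv x *v v)" by (simp add: Winv_form)
  qed
qed

text \<open>The quantifiers stand inside the almost-everywhere statement: the null set must not
  depend on the vectors, because \<open>f x\<close> is inserted later. The free weight
  \<open>s\<close> lets different intervals be treated with different losses.\<close>

lemma AE_young:
  "AE x in lebesgue. \<forall>s u v. 0 < s \<longrightarrow> 2 * (u \<bullet> v) \<le> s * (u \<bullet> (Winv x *v u)) + (1 / s) * (v \<bullet> (W x *v v))"
  using AE_posdef
proof eventually_elim
  case (elim x)
  show ?case
  proof (intro allI impI)
    fix s :: real and u v :: "complex ^ 'n" assume s: "0 < s"
    have "v \<bullet> u \<le> (1 / s) / 2 * (v \<bullet> (W x *v v)) + 1 / (2 * (1 / s)) * inv_form (W x) u"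
      by (rule inv_form_young[OF elim]) (use s in simp)
    then show "2 * (u \<bullet> v) \<le> s * (u \<bullet> (Winv x *v u)) + (1 / s) * (v \<bullet> (W x *v v))"
      by (simp add: Winv_form inner_commute)
  qed
qed

lemma posdef_average:
  assumes H: "locally_integrable H" and herm: "AE x in lebesgue. hermitian (H x)"
    and pos: "AE x in lebesgue. \<forall>v. v \<noteq> 0 \<longrightarrow> 0 < v \<bullet> (H x *v v)" and ab: "a < b"
  shows "posdef (average H a b :: complex ^ 'n ^ 'n)"
  unfolding posdef_def
proof (intro conjI allI impI hermitianI)
  fix u v :: "complex ^ 'n"
  have eq: "(LINT x:{a..b}|lebesgue. v \<bullet> (H x *v u)) = (LINT x:{a..b}|lebesgue. u \<bullet> (H x *v v))"
  proof (intro antisym set_integral_mono_lebesgue set_integrable_matrix_form H)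
    show "AE x in lebesgue. x \<in> {a..b} \<longrightarrow> v \<bullet> (H x *v u) \<le> u \<bullet> (H x *v v)"
      using herm by eventually_elim (simp add: hermitian_inner_commute)
    show "AE x in lebesgue. x \<in> {a..b} \<longrightarrow> u \<bullet> (H x *v v) \<le> v \<bullet> (H x *v u)"
      using herm by eventually_elim (metis hermitian_inner_commute order_refl)
  qed
  then show "(average H a b *v u) \<bullet> v = u \<bullet> (average H a b *v v)"
    using ab by (simp add: set_integral_matrix_form[OF H ab] inner_commute)
next
  fix v :: "complex ^ 'n" assume v: "v \<noteq> 0"
  have "AE x in lebesgue. 0 < v \<bullet> (H x *v v)"
    using pos by eventually_elim (use v in auto)
  then have "0 < (LINT x:{a..b}|lebesgue. v \<bullet> (H x *v v))"
    by (intro set_integral_pos set_integrable_matrix_form H ab)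
  then show "0 < v \<bullet> (average H a b *v v)"
    using ab by (simp add: set_integral_matrix_form[OF H ab] zero_less_mult_iff)
qed

lemma posdef_X: "a < b \<Longrightarrow> posdef (X a b)"
proof (rule posdef_average[OF loc_W])
  show "AE x in lebesgue. hermitian (W x)"
    using AE_posdef by eventually_elim (rule posdefD)
  show "AE x in lebesgue. \<forall>v. v \<noteq> 0 \<longrightarrow> 0 < v \<bullet> (W x *v v)"
    using AE_posdef by eventually_elim (simp add: posdefD)
qed

lemma posdef_Y: "a < b \<Longrightarrow> posdef (Y a b)"
proof (rule posdef_average[OF loc_Winv])
  show "AE x in lebesgue. hermitian (Winv x)"
    using AE_posdef by eventually_elim (simp add: Winv_def hermitian_matrix_inv)
  show "AE x in lebesgue. \<forall>v. v \<noteq> 0 \<longrightarrow> 0 < v \<bullet> (Winv x *v v)"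
    by (rule AE_Winv_pos)
qed

text \<open>The pointwise inequality is averaged with constant vectors. Optimising \<open>v\<close>
  or \<open>w\<close> gives both \<open>Y^-1 <= X\<close> and \<open>X^-1 <= Y\<close> for the
  averages.\<close>

lemma average_young:
  assumes ab: "a < b"
  shows "2 * (v \<bullet> w) \<le> w \<bullet> (X a b *v w) + v \<bullet> (Y a b *v v)"
proof -
  have i: "set_integrable lebesgue {a..b} (\<lambda>x. w \<bullet> (W x *v w) + v \<bullet> (Winv x *v v))"
    by (intro set_integral_add set_integrable_matrix_form loc_W loc_Winv)
  have "(LINT x:{a..b}|lebesgue. 2 * (v \<bullet> w)) \<le> (LINT x:{a..b}|lebesgue. w \<bullet> (W x *v w) + v \<bullet> (Winv x *v v))"
  proof (rule set_integral_mono_lebesgue[OF _ i])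
    show "set_integrable lebesgue {a..b} (\<lambda>x. 2 * (v \<bullet> w))"
      by (rule absolutely_integrable_on_const) simp
    show "AE x in lebesgue. x \<in> {a..b} \<longrightarrow> 2 * (v \<bullet> w) \<le> w \<bullet> (W x *v w) + v \<bullet> (Winv x *v v)"
      using AE_young
    proof eventually_elim
      case (elim x)
      from elim[rule_format, of 1 v w] show ?case by simp
    qed
  qed
  also have "(LINT x:{a..b}|lebesgue. 2 * (v \<bullet> w)) = (b - a) * (2 * (v \<bullet> w))"
    using ab by (simp add: set_lebesgue_integral_def)
  also have "(LINT x:{a..b}|lebesgue. w \<bullet> (W x *v w) + v \<bullet> (Winv x *v v))
      = (b - a) * (w \<bullet> (X a b *v w) + v \<bullet> (Y a b *v v))"
    by (simp add: set_integral_add set_integrable_matrix_form loc_W loc_Winv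
        set_integral_matrix_form ab distrib_left)
  finally show ?thesis using ab by simp
qed

lemma A2_pair_averages:
  assumes ab: "a < b"
  shows "A2_pair A (X a b) (Y a b)"
  unfolding A2_pair_def
proof (intro conjI allI)
  show X: "posdef (X a b)" and Y: "posdef (Y a b)"
    using ab by (auto intro: posdef_X posdef_Y)
  fix u
  obtain p where p: "Y a b *v p = u" "inv_form (Y a b) u = p \<bullet> (Y a b *v p)" "inv_form (Y a b) u = p \<bullet> u"
    using posdef_solution[OF Y] by metis
  show "inv_form (Y a b) u \<le> u \<bullet> (X a b *v u)"
    using average_young[OF ab, of p u] p by simp
  have "A2_quantity W a b \<le> A"
    unfolding A_def A2_const_def
    using A2 ab cSUP_upper[of "(a, b)" "{(a, b). a < b}" "\<lambda>(a, b). A2_quantity W a b"]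
    by (simp add: matrix_A2_def)
  then have "A2_quantity W a b * (p \<bullet> (Y a b *v p)) \<le> A * (p \<bullet> (Y a b *v p))"
    by (intro mult_right_mono posdef_nonneg[OF Y])
  then show "u \<bullet> (X a b *v u) \<le> A * inv_form (Y a b) u"
    using onorm_psd_sqrt_product[OF X Y, of p] p by (simp add: A2_quantity_def Winv_eq)
qed

lemma A_ge_1: "1 \<le> A"
  by (rule A2_pair_logdet(1)[OF A2_pair_averages[of 0 1]]) simp

end

section \<open>The dyadic induction\<close>

primrec leaf_sum :: "(real \<Rightarrow> real \<Rightarrow> real) \<Rightarrow> nat \<Rightarrow> real \<Rightarrow> real \<Rightarrow> real" where
  "leaf_sum \<phi> 0 a b = \<phi> a b"
| "leaf_sum \<phi> (Suc n) a b = leaf_sum \<phi> n a ((a + b) / 2) + leaf_sum \<phi> n ((a + b) / 2) b"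

primrec node_sum :: "(real \<Rightarrow> real \<Rightarrow> real) \<Rightarrow> nat \<Rightarrow> real \<Rightarrow> real \<Rightarrow> real" where
  "node_sum \<phi> 0 a b = 0"
| "node_sum \<phi> (Suc n) a b = \<phi> a b + (node_sum \<phi> n a ((a + b) / 2) + node_sum \<phi> n ((a + b) / 2) b)"

text \<open>The mean of the step function that takes, on each leaf, the value of \<open>g\<close> at
  the left endpoint. Finitely many samples of \<open>g\<close> thus drive an induction of finite
  depth.\<close>

primrec leaf_average :: "(real \<Rightarrow> 'a::real_vector) \<Rightarrow> nat \<Rightarrow> real \<Rightarrow> real \<Rightarrow> 'a" where
  "leaf_average g 0 a b = g a"
| "leaf_average g (Suc n) a b =
     (1 / 2) *\<^sub>R (leaf_average g n a ((a + b) / 2) + leaf_average g n ((a + b) / 2) b)"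

lemma leaf_sum_ge:
  assumes ab: "a < b"
    and add: "\<And>c d. a \<le> c \<Longrightarrow> c < d \<Longrightarrow> d \<le> b \<Longrightarrow> \<psi> c d = \<psi> c ((c + d) / 2) + \<psi> ((c + d) / 2) d"
    and leaf: "\<And>c d. a \<le> c \<Longrightarrow> c < d \<Longrightarrow> d \<le> b \<Longrightarrow> d - c \<le> (b - a) / 2 ^ n \<Longrightarrow> \<psi> c d \<le> \<phi> c d"
  shows "\<psi> a b \<le> leaf_sum \<phi> n a b"
  using assms
proof (induction n arbitrary: a b)
  case 0
  show ?case using 0(1) 0(3)[of a b] by simp
next
  case (Suc n)
  define m where "m = (a + b) / 2"
  have m: "a < m" "m < b" "m - a = (b - a) / 2" "b - m = (b - a) / 2"
    using Suc.prems(1) by (auto simp: m_def field_simps)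
  have scale: "(m - a) / 2 ^ n = (b - a) / 2 ^ Suc n" "(b - m) / 2 ^ n = (b - a) / 2 ^ Suc n"
    by (simp_all add: m(3,4))
  have "\<psi> a m \<le> leaf_sum \<phi> n a m"
  proof (rule Suc.IH)
    fix c d assume "a \<le> c" "c < d" "d \<le> m" "d - c \<le> (m - a) / 2 ^ n"
    then show "\<psi> c d \<le> \<phi> c d" using m(2) scale by (intro Suc.prems(3)) auto
  qed (use m Suc.prems(2) in auto)
  moreover have "\<psi> m b \<le> leaf_sum \<phi> n m b"
  proof (rule Suc.IH)
    fix c d assume "m \<le> c" "c < d" "d \<le> b" "d - c \<le> (b - m) / 2 ^ n"
    then show "\<psi> c d \<le> \<phi> c d" using m(1) scale by (intro Suc.prems(3)) auto
  qed (use m Suc.prems(2) in auto)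
  ultimately show ?case
    using Suc.prems(2)[of a b] Suc.prems(1) by (simp add: m_def)
qed

lemma AE_lebesgue_neq: "AE x in lebesgue. x \<noteq> (c::real)"
  by (rule AE_completion) (rule AE_lborel_singleton)

section \<open>Haar coefficients of f and the estimate at finite depth\<close>

locale A2_weight_function = A2_weight W for W :: "real \<Rightarrow> complex ^ 'n ^ 'n" +
  fixes f :: "real \<Rightarrow> complex ^ 'n"
  assumes f: "f \<in> weighted_L2 W"
begin

definition energy :: "real \<Rightarrow> real" where
  "energy x = f x \<bullet> (W x *v f x)"

lemma energy_eq: "Re (cinner (W x *v f x) (f x)) = energy x"
  by (simp add: energy_def inner_eq_Re_cinner[symmetric] inner_commute)

lemma f_measurable: "f \<in> borel_measurable lebesgue"
  using f by (simp add: weighted_L2_def)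

lemma energy_integrable: "integrable lebesgue energy"
proof -
  have "energy = (\<lambda>x. Re (cinner (W x *v f x) (f x)))" by (simp add: energy_eq fun_eq_iff)
  then show ?thesis using f by (simp add: weighted_L2_def)
qed

lemma energy_set_integrable: "set_integrable lebesgue {a..b} energy"
  unfolding set_integrable_def by (rule integrable_mult_indicator[OF _ energy_integrable]) simp

lemma AE_energy_nonneg: "AE x in lebesgue. 0 \<le> energy x"
  using AE_posdef by eventually_elim (simp add: energy_def posdef_nonneg)

text \<open>Young's inequality against a fixed vector \<open>e\<close> bounds each component of
  \<open>f\<close> by the energy density plus the form of \<open>Winv\<close> at \<open>e\<close>,
  both integrable on bounded intervals. This makes the Haar coefficients meaningful.\<close>

lemma f_integrable: "set_integrable lebesgue {a..b} f"
proof (rule absolutely_integrable_componentwise)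
  fix e :: "complex ^ 'n"
  let ?g = "\<lambda>x. energy x + e \<bullet> (Winv x *v e)"
  show "set_integrable lebesgue {a..b} (\<lambda>x. f x \<bullet> e)"
    unfolding set_integrable_def
  proof (rule Bochner_Integration.integrable_bound)
    have "set_integrable lebesgue {a..b} ?g"
      by (intro set_integral_add energy_set_integrable set_integrable_matrix_form loc_Winv)
    then show "integrable lebesgue (\<lambda>x. indicator {a..b} x *\<^sub>R ?g x)"
      by (simp add: set_integrable_def)
    show "(\<lambda>x. indicator {a..b} x *\<^sub>R (f x \<bullet> e)) \<in> borel_measurable lebesgue"
      by (intro borel_measurable_scaleR borel_measurable_indicator borel_measurable_inner f_measurable) auto
    show "AE x in lebesgue. norm (indicator {a..b} x *\<^sub>R (f x \<bullet> e)) \<le> norm (indicator {a..b} x *\<^sub>R ?g x)"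
      using AE_young
    proof eventually_elim
      case (elim x)
      have "2 * (e \<bullet> f x) \<le> ?g x" "2 * ((- e) \<bullet> f x) \<le> ?g x"
        using elim[rule_format, of 1 e "f x"] elim[rule_format, of 1 "- e" "f x"]
        by (simp_all add: energy_def bounded_bilinear.minus_right[OF bounded_bilinear_matrix_vector])
      then show ?case
        by (auto simp: indicator_def inner_commute)
    qed
  qed
qed

definition F :: "real \<Rightarrow> real \<Rightarrow> complex ^ 'n" where
  "F a b = (LINT x:{a..b}|lebesgue. f x)"

definition favg :: "real \<Rightarrow> real \<Rightarrow> complex ^ 'n" where
  "favg a b = (1 / (b - a)) *\<^sub>R F a b"

text \<open>Half the difference between the means of \<open>f\<close> over the right and the left
  half, the normalisation that matches \<open>D\<close>, \<open>E\<close> and \<open>d\<close> in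
  the Bellman step.\<close>

definition jump :: "real \<Rightarrow> real \<Rightarrow> complex ^ 'n" where
  "jump a b = (1 / (b - a)) *\<^sub>R (F ((a + b) / 2) b - F a ((a + b) / 2))"

definition haar_term :: "real \<Rightarrow> real \<Rightarrow> real" where
  "haar_term a b = (b - a) * (jump a b \<bullet> (X a b *v jump a b))"

lemma F_inner: "F a b \<bullet> v = (LINT x:{a..b}|lebesgue. f x \<bullet> v)"
  unfolding F_def by (rule set_integral_bounded_linear(2)[OF bounded_linear_inner_left f_integrable, symmetric])

lemma F_combine: "a \<le> c \<Longrightarrow> c \<le> b \<Longrightarrow> F a b = F a c + F c b"
  unfolding F_def by (rule set_integral_combine[OF f_integrable])

lemma haar_coeff_eq:
  assumes ab: "a < b"
  shows "haar_coeff f a b = sqrt (b - a) *\<^sub>R jump a b"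
proof -
  define m where "m = (a + b) / 2"
  have m: "a < m" "m < b" using ab by (auto simp: m_def)
  let ?l = "\<lambda>x. indicator {a..m} x *\<^sub>R f x" and ?r = "\<lambda>x. indicator {m..b} x *\<^sub>R f x"
  have il: "integrable lebesgue ?l" and ir: "integrable lebesgue ?r"
    using f_integrable by (auto simp: set_integrable_def)
  have "haar_coeff f a b = (LINT x|lebesgue. (1 / sqrt (b - a)) *\<^sub>R (?r x - ?l x))"
    unfolding haar_coeff_def set_lebesgue_integral_def
  proof (rule integral_cong_AE)
    show "(\<lambda>x. indicator {a..<b} x *\<^sub>R haar a b x *\<^sub>R f x) \<in> borel_measurable lebesgue"
      unfolding haar_def
      by (intro borel_measurable_scaleR borel_measurable_indicator borel_measurable_divide
          borel_measurable_diff borel_measurable_const f_measurable) auto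
    show "(\<lambda>x. (1 / sqrt (b - a)) *\<^sub>R (?r x - ?l x)) \<in> borel_measurable lebesgue"
      by (intro borel_measurable_scaleR borel_measurable_indicator borel_measurable_diff
          borel_measurable_const f_measurable) auto
    \<comment> \<open>The half-open intervals of \<open>haar\<close> and the closed ones of
      \<open>F\<close> differ only at the midpoint and the right endpoint.\<close>
    show "AE x in lebesgue. indicator {a..<b} x *\<^sub>R haar a b x *\<^sub>R f x = (1 / sqrt (b - a)) *\<^sub>R (?r x - ?l x)"
      using AE_lebesgue_neq[of m] AE_lebesgue_neq[of b]
    proof eventually_elim
      case (elim x)
      then show ?case
        using m by (auto simp: haar_def indicator_def m_def[symmetric] not_less)
    qed
  qed
  also have "\<dots> = (1 / sqrt (b - a)) *\<^sub>R (F m b - F a m)"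
    using il ir by (simp add: F_def set_lebesgue_integral_def Bochner_Integration.integral_diff)
  also have "\<dots> = sqrt (b - a) *\<^sub>R jump a b"
  proof -
    have "sqrt (b - a) * (1 / (b - a)) = 1 / sqrt (b - a)"
      using ab by (simp add: divide_simps)
    then show ?thesis by (simp only: jump_def m_def[symmetric] scaleR_scaleR)
  qed
  finally show ?thesis .
qed

lemma haar_term_eq:
  assumes "a < b"
  shows "Re (cinner (X a b *v haar_coeff f a b) (haar_coeff f a b)) = haar_term a b"
  using assms by (simp add: haar_coeff_eq haar_term_def mv_scaleR_right inner_commute
      flip: inner_eq_Re_cinner)

lemma haar_term_nonneg: "a < b \<Longrightarrow> 0 \<le> haar_term a b"
  unfolding haar_term_def by (intro mult_nonneg_nonneg posdef_nonneg posdef_X) auto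

definition C :: real where
  "C = 1 + 32 * real CARD('n) * A * (1 + ln A)"

lemma C_pos: "0 < C"
  using A_ge_1 by (simp add: C_def add_pos_nonneg)

text \<open>The integral of <f, g> - <W^-1 g, g> / 2 over the interval, with \<open>g\<close> frozen
  at its left endpoint.\<close>

definition dual_gain :: "(real \<Rightarrow> complex ^ 'n) \<Rightarrow> real \<Rightarrow> real \<Rightarrow> real" where
  "dual_gain g a b = F a b \<bullet> g a - (b - a) * (g a \<bullet> (Y a b *v g a)) / 2"

lemma inv_form_X_le:
  assumes ab: "a < b"
  shows "inv_form (X a b) g \<le> g \<bullet> (Y a b *v g)"
proof -
  obtain w where w: "inv_form (X a b) g = w \<bullet> (X a b *v w)" "inv_form (X a b) g = w \<bullet> g"
    using posdef_solution[OF posdef_X[OF ab]] by metis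
  then show ?thesis
    using average_young[OF ab, of g w] by (simp add: inner_commute)
qed

text \<open>The subtracted Bellman term is the reserve of the induction. At a leaf it is covered by
  the quadratic part of \<open>dual_gain\<close>, since \<open>bellman\<close> is at most
  \<open>C\<close> times \<open>inv_form\<close>. At a node \<open>bellman_step\<close> releases
  enough of it to absorb the cross term between the jumps of \<open>f\<close> and of the sampled
  \<open>g\<close>, leaving \<open>C * haar_term\<close>.\<close>

lemma dyadic_bellman_induction:
  assumes "a < b"
  shows "leaf_sum (dual_gain g) n a b \<le> F a b \<bullet> leaf_average g n a b + C * node_sum haar_term n a b
    - (b - a) / (2 * C) * bellman A (X a b) (Y a b) (leaf_average g n a b)"
  using assms
proof (induction n arbitrary: a b)
  case 0
  have "bellman A (X a b) (Y a b) (g a) \<le> C * inv_form (X a b) (g a)"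
    unfolding C_def by (rule bellman_bounds(2)[OF A2_pair_averages[OF 0]])
  also have "\<dots> \<le> C * (g a \<bullet> (Y a b *v g a))"
    using C_pos by (intro mult_left_mono inv_form_X_le 0) auto
  finally have "(b - a) / (2 * C) * bellman A (X a b) (Y a b) (g a)
      \<le> (b - a) / (2 * C) * (C * (g a \<bullet> (Y a b *v g a)))"
    using 0 C_pos by (intro mult_left_mono) auto
  also have "\<dots> = (b - a) * (g a \<bullet> (Y a b *v g a)) / 2"
    using C_pos by simp
  finally show ?case by (simp add: dual_gain_def)
next
  case (Suc n)
  define m where "m = (a + b) / 2"
  have m: "a < m" "m < b" "m - a = (b - a) / 2" "b - m = (b - a) / 2"
    using Suc.prems by (auto simp: m_def field_simps)
  define h where "h = b - a"
  have h: "h > 0" using Suc.prems by (simp add: h_def)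
  define D where "D = (1 / 2) *\<^sub>R (X m b - X a m)"
  define E where "E = (1 / 2) *\<^sub>R (Y m b - Y a m)"
  have half: "(1 / 2) *\<^sub>R (p + q) + (1 / 2) *\<^sub>R (q - p) = q" "(1 / 2) *\<^sub>R (p + q) - (1 / 2) *\<^sub>R (q - p) = p"
    for p q :: "'v::real_vector"
    by (simp_all add: algebra_simps flip: scaleR_add_left)
  have X: "X a b = (1 / 2) *\<^sub>R (X a m + X m b)" and Y: "Y a b = (1 / 2) *\<^sub>R (Y a m + Y m b)"
    using average_halves[OF loc_W Suc.prems] average_halves[OF loc_Winv Suc.prems] by (simp_all add: m_def)
  have XD: "X a b + D = X m b" "X a b - D = X a m" and YE: "Y a b + E = Y m b" "Y a b - E = Y a m"
    unfolding X Y D_def E_def half by (rule refl)+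
  define \<beta>1 \<beta>2 where "\<beta>1 = leaf_average g n a m" and "\<beta>2 = leaf_average g n m b"
  define \<beta> d where "\<beta> = (1 / 2) *\<^sub>R (\<beta>1 + \<beta>2)" and "d = (1 / 2) *\<^sub>R (\<beta>2 - \<beta>1)"
  have bd: "\<beta> + d = \<beta>2" "\<beta> - d = \<beta>1"
    unfolding \<beta>_def d_def half by (rule refl)+
  define B B1 B2 where "B = bellman A (X a b) (Y a b) \<beta>" and "B1 = bellman A (X a m) (Y a m) \<beta>1"
    and "B2 = bellman A (X m b) (Y m b) \<beta>2"
  have step: "B + inv_form (X a b) d / 2 \<le> (B2 + B1) / 2"
    using bellman_step[of A "X a b" "Y a b" D E \<beta> d] A2_pair_averages[OF Suc.prems]
      A2_pair_averages[OF m(1)] A2_pair_averages[OF m(2)]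
    by (simp add: XD YE bd B_def B1_def B2_def)
  \<comment> \<open>The weight \<open>2 * C\<close> is chosen so that the coefficient
    \<open>1 / (4 * C)\<close> equals the one with which the Bellman reserve supplies
    \<open>inv_form (X a b) d\<close>.\<close>
  have young: "jump a b \<bullet> d \<le> C * (jump a b \<bullet> (X a b *v jump a b)) + 1 / (4 * C) * inv_form (X a b) d"
    using inv_form_young[OF posdef_X[OF Suc.prems], of "2 * C" "jump a b" d] C_pos by simp
  have "h * (jump a b \<bullet> d) \<le> C * haar_term a b + h / (2 * C) * (inv_form (X a b) d / 2)"
    using mult_left_mono[OF young, of h] h
    by (simp add: haar_term_def h_def[symmetric] distrib_left mult.left_commute)
  also have "\<dots> \<le> C * haar_term a b + h / (2 * C) * ((B2 + B1) / 2 - B)"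
  proof (intro add_left_mono mult_left_mono)
    show "inv_form (X a b) d / 2 \<le> (B2 + B1) / 2 - B" using step by linarith
  qed (use h C_pos in auto)
  finally have 1: "h * (jump a b \<bullet> d) \<le> C * haar_term a b + h / (2 * C) * ((B2 + B1) / 2 - B)" .
  have "h *\<^sub>R jump a b = F m b - F a m"
    using h by (simp add: jump_def h_def m_def)
  then have "h * (jump a b \<bullet> d) = (F m b - F a m) \<bullet> d"
    by (metis inner_scaleR_left)
  then have 2: "F a m \<bullet> \<beta>1 + F m b \<bullet> \<beta>2 = F a b \<bullet> \<beta> + h * (jump a b \<bullet> d)"
    using m by (simp add: F_combine[of a m b] bd[symmetric] inner_add_left inner_add_right inner_diff_left inner_diff_right)
  have 3: "leaf_sum (dual_gain g) n a m \<le> F a m \<bullet> \<beta>1 + C * node_sum haar_term n a m - (h / 2) / (2 * C) * B1"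
    using Suc.IH[OF m(1)] by (simp only: m(3) \<beta>1_def B1_def h_def)
  have 4: "leaf_sum (dual_gain g) n m b \<le> F m b \<bullet> \<beta>2 + C * node_sum haar_term n m b - (h / 2) / (2 * C) * B2"
    using Suc.IH[OF m(2)] by (simp only: m(4) \<beta>2_def B2_def h_def)
  have arith: "l1 + l2 \<le> p + C * (t + (n1 + n2)) - k * B"
    if "l1 \<le> p1 + C * n1 - k1 * B1" "l2 \<le> p2 + C * n2 - k1 * B2" "p1 + p2 = p + j" "j \<le> C * t + k * ((B2 + B1) / 2 - B)"
      "k1 = k / 2" for l1 l2 p1 p2 p t n1 n2 j k k1 :: real
    using that by (simp add: algebra_simps add_divide_distrib)
  show ?case
    using arith[OF 3 4 2 1] by (simp add: m_def \<beta>1_def \<beta>2_def \<beta>_def B_def h_def)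
qed

text \<open>The reserve left at the root absorbs the pairing of \<open>F a b\<close> with the mean
  of the sampled \<open>g\<close>. The bound no longer contains \<open>g\<close>, only the mean and
  the Haar terms of \<open>f\<close>.\<close>

lemma dyadic_bound:
  assumes ab: "a < b"
  shows "leaf_sum (dual_gain g) n a b
    \<le> C / 2 * ((b - a) * (favg a b \<bullet> (X a b *v favg a b))) + C * node_sum haar_term n a b"
proof -
  define \<beta> where "\<beta> = leaf_average g n a b"
  have "favg a b \<bullet> \<beta> \<le> C / 2 * (favg a b \<bullet> (X a b *v favg a b)) + 1 / (2 * C) * inv_form (X a b) \<beta>"
    by (rule inv_form_young[OF posdef_X[OF ab] C_pos])
  also have "\<dots> \<le> C / 2 * (favg a b \<bullet> (X a b *v favg a b)) + 1 / (2 * C) * bellman A (X a b) (Y a b) \<beta>"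
    using C_pos by (intro add_left_mono mult_left_mono bellman_bounds(1)[OF A2_pair_averages[OF ab]]) auto
  finally have 1: "(b - a) * (favg a b \<bullet> \<beta>)
      \<le> (b - a) * (C / 2 * (favg a b \<bullet> (X a b *v favg a b)) + 1 / (2 * C) * bellman A (X a b) (Y a b) \<beta>)"
    using ab by (intro mult_left_mono) auto
  have 2: "(b - a) * (favg a b \<bullet> \<beta>) = F a b \<bullet> \<beta>"
    using ab by (simp add: favg_def)
  have 3: "(b - a) * (C / 2 * s + 1 / (2 * C) * B) = C / 2 * ((b - a) * s) + (b - a) / (2 * C) * B" for s B
    by (simp add: distrib_left)
  show ?thesis
    using dyadic_bellman_induction[OF ab, of g n] 1[unfolded 2 3] unfolding \<beta>_def by linarith
qed

end

section \<open>Passage to the limit\<close>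

context A2_weight_function
begin

text \<open>
  The supremum of this expression over all values of \<open>g x\<close> is half the energy density of \<open>f\<close> at \<open>x\<close>,
  attained at \<open>g = W f\<close>. Bounding its integral for every \<open>g\<close> makes Lebesgue differentiation
  of \<open>f\<close> and \<open>W\<close> unnecessary.
\<close>

definition lagrange :: "(real \<Rightarrow> complex ^ 'n) \<Rightarrow> real \<Rightarrow> real" where
  "lagrange g x = f x \<bullet> g x - (g x \<bullet> (Winv x *v g x)) / 2"

text \<open>Scaled by \<open>G\<close> it dominates \<open>lagrange g\<close> for every
  \<open>g\<close> bounded by \<open>G\<close>; scaled by a small number it bounds the loss when
  \<open>g x\<close> is replaced by a nearby value.\<close>

definition majorant :: "real \<Rightarrow> real \<Rightarrow> real \<Rightarrow> real" where
  "majorant K G x = norm (f x) + G * K * norm (Winv x)"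

lemma majorant_integrable: "set_integrable lebesgue {a..b} (majorant K G)"
  unfolding majorant_def
  by (intro set_integral_add set_integrable_mult_right set_integrable_norm f_integrable
      locally_integrable_matrix loc_Winv)

lemma scaled_majorant_integrable:
  "integrable lebesgue (\<lambda>x. indicator {a..b} x *\<^sub>R (G * majorant K G x))"
proof -
  have "set_integrable lebesgue {a..b} (\<lambda>x. G * majorant K G x)"
    by (intro set_integrable_mult_right majorant_integrable)
  then show ?thesis by (simp add: set_integrable_def)
qed

lemma matrix_form_bound:
  obtains K where "0 < K"
    "\<And>(M :: complex ^ 'n ^ 'n) u v. \<bar>u \<bullet> (M *v v)\<bar> \<le> K * norm M * (norm u * norm v)"
proof -
  obtain K where K: "0 < K" "\<And>(M :: complex ^ 'n ^ 'n) v. norm (M *v v) \<le> norm M * norm v * K"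
    using bounded_bilinear.pos_bounded[OF bounded_bilinear_matrix_vector] by blast
  have "\<bar>u \<bullet> (M *v v)\<bar> \<le> K * norm M * (norm u * norm v)" for u v and M :: "complex ^ 'n ^ 'n"
  proof -
    have "\<bar>u \<bullet> (M *v v)\<bar> \<le> norm u * norm (M *v v)" by (rule Cauchy_Schwarz_ineq2)
    also have "\<dots> \<le> norm u * (norm M * norm v * K)" by (intro mult_left_mono K) auto
    finally show ?thesis by (simp add: mult_ac)
  qed
  with K(1) show ?thesis using that by blast
qed

lemma lagrange_bound:
  assumes K: "\<And>(M :: complex ^ 'n ^ 'n) u v. \<bar>u \<bullet> (M *v v)\<bar> \<le> K * norm M * (norm u * norm v)"
    and G: "norm (g x) \<le> G" and K0: "0 < K"
  shows "\<bar>lagrange g x\<bar> \<le> G * majorant K G x"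
proof -
  have G0: "0 \<le> G" using G norm_ge_zero order_trans by blast
  have "\<bar>f x \<bullet> g x\<bar> \<le> norm (f x) * norm (g x)" by (rule Cauchy_Schwarz_ineq2)
  also have "\<dots> \<le> norm (f x) * G" by (intro mult_left_mono G) auto
  finally have 1: "\<bar>f x \<bullet> g x\<bar> \<le> norm (f x) * G" .
  have "\<bar>g x \<bullet> (Winv x *v g x)\<bar> \<le> K * norm (Winv x) * (norm (g x) * norm (g x))" by (rule K)
  also have "\<dots> \<le> K * norm (Winv x) * (G * G)"
    using K0 G G0 by (intro mult_left_mono mult_mono) auto
  finally have "\<bar>g x \<bullet> (Winv x *v g x)\<bar> \<le> K * norm (Winv x) * (G * G)" .
  with 1 have "\<bar>lagrange g x\<bar> \<le> norm (f x) * G + K * norm (Winv x) * (G * G)"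
    unfolding lagrange_def by linarith
  then show ?thesis by (simp add: majorant_def algebra_simps)
qed

lemma matrix_vector_measurable:
  fixes M :: "real \<Rightarrow> complex ^ 'n ^ 'n"
  assumes "M \<in> borel_measurable lebesgue" "g \<in> borel_measurable lebesgue"
  shows "(\<lambda>x. M x *v g x) \<in> borel_measurable lebesgue"
  by (rule borel_measurable_continuous_Pair[OF assms])
    (intro bounded_bilinear.continuous_on[OF bounded_bilinear_matrix_vector] continuous_intros)

lemma lagrange_measurable:
  assumes g: "g \<in> borel_measurable lebesgue"
  shows "(\<lambda>x. indicator {a..b} x *\<^sub>R lagrange g x) \<in> borel_measurable lebesgue"
proof -
  have eq: "(\<lambda>x. indicator {a..b} x *\<^sub>R lagrange g x)
      = (\<lambda>x. indicator {a..b} x *\<^sub>R (f x \<bullet> g x) - (g x \<bullet> ((indicator {a..b} x *\<^sub>R Winv x) *v g x)) / 2)"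
    by (simp add: lagrange_def mv_scaleR_left right_diff_distrib)
  have "(\<lambda>x. indicator {a..b} x *\<^sub>R Winv x) \<in> borel_measurable lebesgue"
    using locally_integrable_matrix[OF loc_Winv, of a b] unfolding set_integrable_def
    by (rule borel_measurable_integrable)
  then have "(\<lambda>x. (indicator {a..b} x *\<^sub>R Winv x) *v g x) \<in> borel_measurable lebesgue"
    by (rule matrix_vector_measurable[OF _ g])
  then have "(\<lambda>x. g x \<bullet> ((indicator {a..b} x *\<^sub>R Winv x) *v g x) / 2) \<in> borel_measurable lebesgue"
    by (intro borel_measurable_divide borel_measurable_const borel_measurable_inner g)
  moreover have "(\<lambda>x. indicator {a..b} x *\<^sub>R (f x \<bullet> g x)) \<in> borel_measurable lebesgue"
    by (intro borel_measurable_scaleR borel_measurable_indicator borel_measurable_inner f_measurable g) auto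
  ultimately show ?thesis
    unfolding eq by (rule borel_measurable_diff[rotated])
qed

lemma lagrange_integrable:
  assumes g: "g \<in> borel_measurable lebesgue" and G: "\<And>x. norm (g x) \<le> G"
  shows "set_integrable lebesgue {a..b} (lagrange g)"
proof -
  obtain K where K: "0 < K"
    "\<And>(M :: complex ^ 'n ^ 'n) u v. \<bar>u \<bullet> (M *v v)\<bar> \<le> K * norm M * (norm u * norm v)"
    using matrix_form_bound by blast
  show ?thesis
    unfolding set_integrable_def
  proof (rule Bochner_Integration.integrable_bound)
    show "integrable lebesgue (\<lambda>x. indicator {a..b} x *\<^sub>R (G * majorant K G x))"
      by (rule scaled_majorant_integrable)
    show "AE x in lebesgue. norm (indicator {a..b} x *\<^sub>R lagrange g x)
        \<le> norm (indicator {a..b} x *\<^sub>R (G * majorant K G x))"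
    proof (rule AE_I2)
      fix x
      show "norm (indicator {a..b} x *\<^sub>R lagrange g x) \<le> norm (indicator {a..b} x *\<^sub>R (G * majorant K G x))"
        using lagrange_bound[of K g x G, OF K(2) G K(1)] by (simp add: indicator_def)
    qed
  qed (rule lagrange_measurable[OF g])
qed

definition coarse :: "real \<Rightarrow> real \<Rightarrow> real" where
  "coarse a b = (b - a) * (favg a b \<bullet> (X a b *v favg a b))"

lemma dual_gain_integral:
  assumes "c < d"
  shows "dual_gain g c d = (LINT x:{c..d}|lebesgue. f x \<bullet> g c - (1 / 2) * (g c \<bullet> (Winv x *v g c)))"
    and "set_integrable lebesgue {c..d} (\<lambda>x. f x \<bullet> g c - (1 / 2) * (g c \<bullet> (Winv x *v g c)))"
proof -
  have i: "set_integrable lebesgue {c..d} (\<lambda>x. f x \<bullet> g c)"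
      "set_integrable lebesgue {c..d} (\<lambda>x. (1 / 2) * (g c \<bullet> (Winv x *v g c)))"
    by (intro set_integral_bounded_linear(1)[OF bounded_linear_inner_left f_integrable]
        set_integrable_mult_right set_integrable_matrix_form loc_Winv)+
  then show "set_integrable lebesgue {c..d} (\<lambda>x. f x \<bullet> g c - (1 / 2) * (g c \<bullet> (Winv x *v g c)))"
    by (rule set_integral_diff(1))
  show "dual_gain g c d = (LINT x:{c..d}|lebesgue. f x \<bullet> g c - (1 / 2) * (g c \<bullet> (Winv x *v g c)))"
    unfolding set_integral_diff(2)[OF i] set_integral_mult_right set_integral_matrix_form[OF loc_Winv assms]
    by (simp add: dual_gain_def F_inner)
qed

text \<open>Uniform continuity: on short enough leaves, freezing \<open>g\<close> lowers the
  integrand by at most \<open>\<epsilon> * majorant K G x\<close>. The finite-depth bound is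
  independent of the depth, so \<open>\<epsilon>\<close> can tend to 0.\<close>

lemma lagrange_integral_le_continuous:
  assumes ab: "a < b" and g: "continuous_on UNIV g" and G: "\<And>x. norm (g x) \<le> G"
    and q: "\<And>n. node_sum haar_term n a b \<le> q"
  shows "(LINT x:{a..b}|lebesgue. lagrange g x) \<le> C / 2 * coarse a b + C * q"
proof -
  obtain K where K: "0 < K"
    "\<And>(M :: complex ^ 'n ^ 'n) u v. \<bar>u \<bullet> (M *v v)\<bar> \<le> K * norm M * (norm u * norm v)"
    using matrix_form_bound by blast
  have G0: "0 \<le> G" using G[of 0] norm_ge_zero order_trans by blast
  have gm: "g \<in> borel_measurable lebesgue"
    using borel_measurable_continuous_onI[OF g] by (intro measurable_completion) simp
  let ?H = "\<lambda>\<epsilon> x. lagrange g x - \<epsilon> * majorant K G x"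
  have Hi: "set_integrable lebesgue {c..d} (?H \<epsilon>)" for \<epsilon> c d
    by (intro set_integral_diff set_integrable_mult_right majorant_integrable lagrange_integrable[OF gm G])
  define N where "N = (LINT x:{a..b}|lebesgue. majorant K G x)"
  have key: "(LINT x:{a..b}|lebesgue. lagrange g x) - \<epsilon> * N \<le> C / 2 * coarse a b + C * q" if \<epsilon>: "0 < \<epsilon>" for \<epsilon>
  proof -
    have "uniformly_continuous_on {a..b} g"
      by (intro compact_uniformly_continuous continuous_on_subset[OF g]) auto
    then obtain \<delta> where \<delta>: "0 < \<delta>"
      "\<And>x y. x \<in> {a..b} \<Longrightarrow> y \<in> {a..b} \<Longrightarrow> dist y x < \<delta> \<Longrightarrow> dist (g y) (g x) < \<epsilon>"
      unfolding uniformly_continuous_on_def using \<epsilon> by metis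
    obtain n where n: "(1 / 2) ^ n < \<delta> / (b - a)"
      using real_arch_pow_inv[of "\<delta> / (b - a)" "1 / 2"] \<delta>(1) ab by auto
    then have n': "(b - a) / 2 ^ n < \<delta>"
      using ab by (simp add: field_simps)
    have "(LINT x:{a..b}|lebesgue. ?H \<epsilon> x) \<le> leaf_sum (dual_gain g) n a b"
    proof (rule leaf_sum_ge[OF ab, where \<psi> = "\<lambda>c d. LINT x:{c..d}|lebesgue. ?H \<epsilon> x"])
      fix c d assume "a \<le> c" "c < d" "d \<le> b"
      then show "(LINT x:{c..d}|lebesgue. ?H \<epsilon> x)
        = (LINT x:{c..(c + d) / 2}|lebesgue. ?H \<epsilon> x) + (LINT x:{(c + d) / 2..d}|lebesgue. ?H \<epsilon> x)"
        by (intro set_integral_combine Hi) auto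
    next
      fix c d assume cd: "a \<le> c" "c < d" "d \<le> b" "d - c \<le> (b - a) / 2 ^ n"
      show "(LINT x:{c..d}|lebesgue. ?H \<epsilon> x) \<le> dual_gain g c d"
        unfolding dual_gain_integral(1)[OF cd(2)]
      proof (rule set_integral_mono_lebesgue[OF Hi dual_gain_integral(2)[OF cd(2)]], rule AE_I2, rule impI)
        fix x assume x: "x \<in> {c..d}"
        have "dist (g x) (g c) < \<epsilon>"
          using x cd n' by (intro \<delta>(2)) (auto simp: dist_real_def)
        then have y: "norm (g x - g c) \<le> \<epsilon>" by (simp add: dist_norm)
        have "f x \<bullet> (g x - g c) \<le> norm (f x) * norm (g x - g c)" by (rule norm_cauchy_schwarz)
        also have "\<dots> \<le> norm (f x) * \<epsilon>" by (intro mult_left_mono y) auto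
        finally have 1: "f x \<bullet> g x - f x \<bullet> g c \<le> norm (f x) * \<epsilon>" by (simp add: inner_diff_right)
        have KW: "0 \<le> K * norm (Winv x)" using K by simp
        have "\<bar>(g c - g x) \<bullet> (Winv x *v g c)\<bar> \<le> K * norm (Winv x) * (norm (g c - g x) * norm (g c))" by (rule K)
        also have "\<dots> \<le> K * norm (Winv x) * (\<epsilon> * G)"
          using y G[of c] \<epsilon> KW by (intro mult_left_mono mult_mono) (auto simp: norm_minus_commute)
        finally have 2: "(g c - g x) \<bullet> (Winv x *v g c) \<le> K * norm (Winv x) * (\<epsilon> * G)" by linarith
        have "\<bar>g x \<bullet> (Winv x *v (g c - g x))\<bar> \<le> K * norm (Winv x) * (norm (g x) * norm (g c - g x))" by (rule K)
        also have "\<dots> \<le> K * norm (Winv x) * (G * \<epsilon>)"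
          using y G[of x] G0 KW by (intro mult_left_mono mult_mono) (auto simp: norm_minus_commute)
        finally have 3: "g x \<bullet> (Winv x *v (g c - g x)) \<le> K * norm (Winv x) * (G * \<epsilon>)" by linarith
        have 4: "(g c - g x) \<bullet> (Winv x *v g c) + g x \<bullet> (Winv x *v (g c - g x))
            = g c \<bullet> (Winv x *v g c) - g x \<bullet> (Winv x *v g x)"
          by (simp add: mv_linear_simps inner_diff_left inner_diff_right)
        have 5: "\<epsilon> * majorant K G x = norm (f x) * \<epsilon> + K * norm (Winv x) * (G * \<epsilon>)"
          "K * norm (Winv x) * (\<epsilon> * G) = K * norm (Winv x) * (G * \<epsilon>)"
          by (simp_all add: majorant_def algebra_simps)
        show "?H \<epsilon> x \<le> f x \<bullet> g c - (1 / 2) * (g c \<bullet> (Winv x *v g c))"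
          unfolding lagrange_def 5(1) using 1 2[unfolded 5(2)] 3 4 by linarith
      qed
    qed
    also have "\<dots> \<le> C / 2 * coarse a b + C * node_sum haar_term n a b"
      unfolding coarse_def by (rule dyadic_bound[OF ab])
    also have "\<dots> \<le> C / 2 * coarse a b + C * q"
      using C_pos by (intro add_left_mono mult_left_mono q) auto
    also have "(LINT x:{a..b}|lebesgue. ?H \<epsilon> x) = (LINT x:{a..b}|lebesgue. lagrange g x) - \<epsilon> * N"
      unfolding N_def
      by (subst set_integral_diff(2))
        (auto intro!: set_integrable_mult_right majorant_integrable lagrange_integrable[OF gm G])
    finally show ?thesis .
  qed
  have "((\<lambda>\<epsilon>. (LINT x:{a..b}|lebesgue. lagrange g x) - \<epsilon> * N) \<longlongrightarrow> (LINT x:{a..b}|lebesgue. lagrange g x) - 0 * N) (at_right 0)"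
    by (intro tendsto_intros)
  moreover have "\<forall>\<^sub>F \<epsilon> in at_right 0. (LINT x:{a..b}|lebesgue. lagrange g x) - \<epsilon> * N \<le> C / 2 * coarse a b + C * q"
    using key by (auto simp: eventually_at_right_less eventually_at_filter)
  ultimately show ?thesis
    using tendsto_upperbound[of _ _ "at_right (0::real)"] by fastforce
qed

lemma lagrange_integral_le_bounded:
  assumes ab: "a < b" and g: "g \<in> borel_measurable lebesgue" and G: "\<And>x. norm (g x) \<le> G" and G0: "0 < G"
    and q: "\<And>n. node_sum haar_term n a b \<le> q"
  shows "(LINT x:{a..b}|lebesgue. lagrange g x) \<le> C / 2 * coarse a b + C * q"
proof -
  obtain K where K: "0 < K"
    "\<And>(M :: complex ^ 'n ^ 'n) u v. \<bar>u \<bullet> (M *v v)\<bar> \<le> K * norm M * (norm u * norm v)"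
    using matrix_form_bound by blast
  have "g measurable_on UNIV"
    by (rule lebesgue_measurable_imp_measurable_on) (use g in auto)
  then obtain N \<phi> where N: "negligible N" and \<phi>: "\<And>n::nat. continuous_on UNIV (\<phi> n)"
    and lim: "\<And>x. x \<notin> N \<Longrightarrow> (\<lambda>n. \<phi> n x) \<longlonglongrightarrow> g x"
    unfolding measurable_on_def by auto
  \<comment> \<open>The radial retraction onto the ball of radius \<open>G\<close>. It is continuous
    and fixes the values of \<open>g\<close>, so the approximants keep the uniform bound needed for
    dominated convergence.\<close>
  define \<tau> where "\<tau> y = (G / max G (norm y)) *\<^sub>R y" for y :: "complex ^ 'n"
  have pos: "max G (norm y) > 0" for y :: "complex ^ 'n" using G0 by simp
  have \<tau>c: "continuous_on UNIV \<tau>"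
    unfolding \<tau>_def by (intro continuous_intros) (use pos in \<open>metis less_irrefl\<close>)
  have \<tau>b: "norm (\<tau> y) \<le> G" for y
  proof -
    have "G * norm y \<le> G * max G (norm y)" using G0 by (intro mult_left_mono) auto
    then show ?thesis using G0 pos[of y] by (simp add: \<tau>_def field_simps)
  qed
  have \<tau>g: "\<tau> (g x) = g x" for x
    using G[of x] G0 by (simp add: \<tau>_def max_def)
  define \<psi> where "\<psi> n = \<tau> \<circ> \<phi> n" for n
  have \<psi>c: "continuous_on UNIV (\<psi> n)" for n
    unfolding \<psi>_def by (intro continuous_on_compose \<phi> continuous_on_subset[OF \<tau>c]) auto
  have \<psi>b: "norm (\<psi> n x) \<le> G" for n x by (simp add: \<psi>_def \<tau>b)
  have \<psi>m: "\<psi> n \<in> borel_measurable lebesgue" for n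
    using borel_measurable_continuous_onI[OF \<psi>c] by (intro measurable_completion) simp
  have \<psi>lim: "(\<lambda>n. \<psi> n x) \<longlonglongrightarrow> g x" if "x \<notin> N" for x
  proof -
    have "isCont \<tau> (g x)" using \<tau>c by (simp add: continuous_on_eq_continuous_at)
    from isCont_tendsto_compose[OF this lim[OF that]] show ?thesis by (simp add: \<psi>_def \<tau>g)
  qed
  have "(\<lambda>n. LINT x:{a..b}|lebesgue. lagrange (\<psi> n) x) \<longlonglongrightarrow> (LINT x:{a..b}|lebesgue. lagrange g x)"
    unfolding set_lebesgue_integral_def
  proof (rule integral_dominated_convergence)
    show "integrable lebesgue (\<lambda>x. indicator {a..b} x *\<^sub>R (G * majorant K G x))"
      by (rule scaled_majorant_integrable)
    show "AE x in lebesgue. norm (indicator {a..b} x *\<^sub>R lagrange (\<psi> n) x)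
        \<le> indicator {a..b} x *\<^sub>R (G * majorant K G x)" for n
    proof (rule AE_I2)
      fix x
      show "norm (indicator {a..b} x *\<^sub>R lagrange (\<psi> n) x) \<le> indicator {a..b} x *\<^sub>R (G * majorant K G x)"
        using lagrange_bound[of K "\<psi> n" x G, OF K(2) \<psi>b K(1)] by (simp add: indicator_def)
    qed
    have "AE x in lebesgue. x \<notin> N"
      using N by (simp add: negligible_iff_null_sets AE_not_in)
    then show "AE x in lebesgue. (\<lambda>n. indicator {a..b} x *\<^sub>R lagrange (\<psi> n) x) \<longlonglongrightarrow> indicator {a..b} x *\<^sub>R lagrange g x"
    proof eventually_elim
      case (elim x)
      show ?case
        unfolding lagrange_def
        by (intro tendsto_intros \<psi>lim elim bounded_bilinear.tendsto[OF bounded_bilinear_matrix_vector]) auto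
    qed
  qed (rule lagrange_measurable g \<psi>m)+
  then show ?thesis
    by (rule LIMSEQ_le_const2) (use lagrange_integral_le_continuous[OF ab \<psi>c \<psi>b q] in blast)
qed

definition total_energy :: "real \<Rightarrow> real \<Rightarrow> real" where
  "total_energy a b = (LINT x:{a..b}|lebesgue. energy x)"

lemma energy_le_coarse:
  assumes ab: "a < b" and q: "\<And>n. node_sum haar_term n a b \<le> q"
  shows "total_energy a b \<le> C * coarse a b + 2 * C * q"
proof -
  \<comment> \<open>The optimal \<open>g\<close> is \<open>W f\<close>. The indicator is included
    because the measurability of \<open>W\<close> is drawn from its integrability on bounded
    intervals.\<close>
  define h where "h x = (indicator {a..b} x *\<^sub>R W x) *v f x" for x
  have "(\<lambda>x. indicator {a..b} x *\<^sub>R W x) \<in> borel_measurable lebesgue"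
    using locally_integrable_matrix[OF loc_W, of a b] unfolding set_integrable_def
    by (rule borel_measurable_integrable)
  then have hm: "h \<in> borel_measurable lebesgue"
    unfolding h_def by (intro matrix_vector_measurable f_measurable)
  \<comment> \<open>Cutting off to 0, rather than rescaling, makes \<open>lagrange (g k)\<close>
    equal either to half the energy density or to 0 at almost every point of the interval, so
    \<open>energy\<close> dominates it.\<close>
  define g where "g k x = (if norm (h x) \<le> real (Suc k) then h x else 0)" for k x
  have gm: "g k \<in> borel_measurable lebesgue" for k
  proof -
    have "(\<lambda>x. norm (h x)) \<in> borel_measurable lebesgue" using hm by simp
    then show ?thesis
      unfolding g_def by (intro measurable_If hm borel_measurable_const borel_measurable_le)
  qed
  have gb: "norm (g k x) \<le> real (Suc k)" for k x
    by (simp add: g_def)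
  have eq: "AE x in lebesgue. \<forall>k. indicator {a..b} x *\<^sub>R lagrange (g k) x
      = (if norm (h x) \<le> real (Suc k) then indicator {a..b} x *\<^sub>R ((1 / 2) * energy x) else 0)"
    using AE_posdef
  proof eventually_elim
    case (elim x)
    have "(W x *v f x) \<bullet> (Winv x *v (W x *v f x)) = energy x"
      by (simp add: Winv_def matrix_inv_apply posdef_invertible[OF elim] energy_def inner_commute)
    then show ?case
      by (auto simp: lagrange_def g_def h_def indicator_def energy_def)
  qed
  have "(\<lambda>k. LINT x:{a..b}|lebesgue. lagrange (g k) x) \<longlonglongrightarrow> (LINT x:{a..b}|lebesgue. (1 / 2) * energy x)"
    unfolding set_lebesgue_integral_def
  proof (rule integral_dominated_convergence)
    show "integrable lebesgue energy" by (rule energy_integrable)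
    show "(\<lambda>x. indicator {a..b} x *\<^sub>R ((1 / 2) * energy x)) \<in> borel_measurable lebesgue"
      by (intro borel_measurable_scaleR borel_measurable_indicator borel_measurable_times borel_measurable_const
          borel_measurable_integrable[OF energy_integrable]) auto
    show "AE x in lebesgue. norm (indicator {a..b} x *\<^sub>R lagrange (g k) x) \<le> energy x" for k
      using eq AE_energy_nonneg
    proof eventually_elim
      case (elim x)
      then show ?case by (auto simp: indicator_def)
    qed
    show "AE x in lebesgue. (\<lambda>k. indicator {a..b} x *\<^sub>R lagrange (g k) x)
        \<longlonglongrightarrow> indicator {a..b} x *\<^sub>R ((1 / 2) * energy x)"
      using eq
    proof eventually_elim
      case (elim x)
      obtain k0 where k0: "norm (h x) \<le> real k0" using real_arch_simple by blast
      have "\<forall>\<^sub>F k in sequentially. indicator {a..b} x *\<^sub>R lagrange (g k) x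
          = indicator {a..b} x *\<^sub>R ((1 / 2) * energy x)"
        using eventually_ge_at_top[of k0]
      proof eventually_elim
        case (elim k)
        then have "norm (h x) \<le> real (Suc k)" using k0 by simp
        then show ?case using \<open>\<forall>k. _ k\<close> by simp
      qed
      then show ?case by (rule tendsto_eventually)
    qed
  qed (rule lagrange_measurable gm)+
  then have "(LINT x:{a..b}|lebesgue. (1 / 2) * energy x) \<le> C / 2 * coarse a b + C * q"
    by (rule LIMSEQ_le_const2)
      (use lagrange_integral_le_bounded[OF ab gm gb _ q] in auto)
  then show ?thesis by (simp add: total_energy_def)
qed

lemma total_energy_combine: "a \<le> c \<Longrightarrow> c \<le> b \<Longrightarrow> total_energy a b = total_energy a c + total_energy c b"
  unfolding total_energy_def by (rule set_integral_combine[OF energy_set_integrable])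

section \<open>Growth of the mass of the inverse weight and decay of the mean term\<close>

definition dual_mass :: "complex ^ 'n \<Rightarrow> real \<Rightarrow> real \<Rightarrow> real" where
  "dual_mass u a b = (LINT x:{a..b}|lebesgue. u \<bullet> (Winv x *v u))"

lemma dual_mass_combine: "a \<le> c \<Longrightarrow> c \<le> b \<Longrightarrow> dual_mass u a b = dual_mass u a c + dual_mass u c b"
  unfolding dual_mass_def by (rule set_integral_combine[OF set_integrable_matrix_form[OF loc_Winv]])

lemma dual_mass_eq: "a < b \<Longrightarrow> dual_mass u a b = (b - a) * (u \<bullet> (Y a b *v u))"
  unfolding dual_mass_def by (rule set_integral_matrix_form[OF loc_Winv])

lemma integral_young:
  assumes s: "0 < s"
  shows "2 * (F c d \<bullet> u) \<le> s * dual_mass u c d + (1 / s) * total_energy c d"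
proof -
  have "2 * (F c d \<bullet> u) = (LINT x:{c..d}|lebesgue. 2 * (f x \<bullet> u))"
    by (simp add: F_inner)
  also have "\<dots> \<le> (LINT x:{c..d}|lebesgue. s * (u \<bullet> (Winv x *v u)) + (1 / s) * energy x)"
  proof (rule set_integral_mono_lebesgue)
    show "set_integrable lebesgue {c..d} (\<lambda>x. 2 * (f x \<bullet> u))"
      by (intro set_integrable_mult_right set_integral_bounded_linear(1)[OF bounded_linear_inner_left f_integrable])
    show "set_integrable lebesgue {c..d} (\<lambda>x. s * (u \<bullet> (Winv x *v u)) + (1 / s) * energy x)"
      by (intro set_integral_add set_integrable_mult_right set_integrable_matrix_form loc_Winv energy_set_integrable)
    show "AE x in lebesgue. x \<in> {c..d} \<longrightarrow> 2 * (f x \<bullet> u) \<le> s * (u \<bullet> (Winv x *v u)) + (1 / s) * energy x"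
      using AE_young
    proof eventually_elim
      case (elim x)
      from elim[rule_format, OF s, of u "f x"] show ?case by (simp add: energy_def inner_commute)
    qed
  qed
  also have "\<dots> = s * dual_mass u c d + (1 / s) * total_energy c d"
    unfolding dual_mass_def total_energy_def
    by (subst set_integral_add(2))
      (intro set_integrable_mult_right set_integrable_matrix_form loc_Winv energy_set_integrable
        | simp only: set_integral_mult_right)+
  finally show ?thesis .
qed

text \<open>By the A_2 bound it suffices to measure the mean with the inverse of
  \<open>Y a b\<close>, which pairs \<open>F a b\<close> with a fixed \<open>u\<close>. On the inner
  interval Young's inequality may use the large weight \<open>1 / (2 * \<Lambda>)\<close>, because
  the mass there is small, so the inner energy counts only with factor \<open>2 * \<Lambda>\<close>;
  outside, the weight is 1/2. The resulting masses total at most one copy of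
  \<open>dual_mass u a b\<close> and are absorbed.\<close>

lemma coarse_le:
  assumes ab: "a < b" and cd: "a \<le> c" "c < d" "d \<le> b" and \<Lambda>: "0 < \<Lambda>"
    and mass: "\<And>u. dual_mass u c d \<le> \<Lambda> * dual_mass u a b"
  shows "coarse a b \<le> A * (2 * (total_energy a b - total_energy c d) + 2 * \<Lambda> * total_energy c d)"
proof -
  obtain u where u: "Y a b *v u = favg a b" "inv_form (Y a b) (favg a b) = u \<bullet> (Y a b *v u)"
    "inv_form (Y a b) (favg a b) = u \<bullet> favg a b"
    using posdef_solution[OF posdef_Y[OF ab]] by metis
  have "coarse a b \<le> (b - a) * (A * inv_form (Y a b) (favg a b))"
    unfolding coarse_def using ab by (intro mult_left_mono A2_pairD(4)[OF A2_pair_averages[OF ab]]) auto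
  then have "coarse a b \<le> A * ((b - a) * inv_form (Y a b) (favg a b))"
    by (simp add: mult_ac)
  also have "\<dots> \<le> A * (2 * (total_energy a b - total_energy c d) + 2 * \<Lambda> * total_energy c d)"
  proof (rule mult_left_mono)
    have 1: "(b - a) * inv_form (Y a b) (favg a b) = dual_mass u a b"
      by (simp add: dual_mass_eq[OF ab] u(2))
    have 2: "(b - a) * inv_form (Y a b) (favg a b) = F a b \<bullet> u"
      unfolding u(3) using ab by (simp add: favg_def inner_commute)
    have F: "F a b \<bullet> u = F a c \<bullet> u + F c d \<bullet> u + F d b \<bullet> u"
      using cd by (simp add: F_combine[of a c b] F_combine[of c d b] inner_add_left)
    have v: "dual_mass u a b = dual_mass u a c + dual_mass u c d + dual_mass u d b"
      using cd by (simp add: dual_mass_combine[of a c b] dual_mass_combine[of c d b])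
    have T: "total_energy a b = total_energy a c + total_energy c d + total_energy d b"
      using cd by (simp add: total_energy_combine[of a c b] total_energy_combine[of c d b])
    have "dual_mass u c d \<ge> 0"
      using cd by (simp add: dual_mass_eq posdef_nonneg[OF posdef_Y])
    have "1 / (2 * \<Lambda>) * dual_mass u c d \<le> 1 / (2 * \<Lambda>) * (\<Lambda> * dual_mass u a b)"
      using \<Lambda> by (intro mult_left_mono mass) auto
    then have 3: "1 / (2 * \<Lambda>) * dual_mass u c d \<le> dual_mass u a b / 2" using \<Lambda> by simp
    have "2 * (F c d \<bullet> u) \<le> 1 / (2 * \<Lambda>) * dual_mass u c d + 1 / (1 / (2 * \<Lambda>)) * total_energy c d"
      by (rule integral_young) (use \<Lambda> in simp)
    then have 4: "2 * (F c d \<bullet> u) \<le> 1 / (2 * \<Lambda>) * dual_mass u c d + 2 * \<Lambda> * total_energy c d"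
      by simp
    have 5: "2 * (F a c \<bullet> u) \<le> dual_mass u a c / 2 + 2 * total_energy a c"
      using integral_young[of "1/2" a c u] by simp
    have 6: "2 * (F d b \<bullet> u) \<le> dual_mass u d b / 2 + 2 * total_energy d b"
      using integral_young[of "1/2" d b u] by simp
    show "(b - a) * inv_form (Y a b) (favg a b) \<le> 2 * (total_energy a b - total_energy c d) + 2 * \<Lambda> * total_energy c d"
    proof -
      have arith: "i \<le> 2 * (t - t2) + s"
        if "i = v" "i = x" "r \<le> v / 2" "2 * x2 \<le> r + s" "2 * x1 \<le> v1 / 2 + 2 * t1"
          "2 * x3 \<le> v3 / 2 + 2 * t3" "x = x1 + x2 + x3" "v = v1 + v2 + v3" "t = t1 + t2 + t3" "0 \<le> v2"
        for i x x1 x2 x3 r t t1 t2 t3 v v1 v2 v3 s :: real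
        using that by simp
      show ?thesis
        by (rule arith[OF 1 2 3 4 5 6 F v T \<open>dual_mass u c d \<ge> 0\<close>])
    qed
  qed (use A_ge_1 in simp)
  finally show ?thesis .
qed

text \<open>The mass of \<open>W\<close> on the half is at most that on the whole, where the A_2
  bound compares it with the inverse of \<open>Y a b\<close>; Young's inequality on the half turns
  this upper bound for \<open>X c d\<close> into a lower bound for \<open>Y c d\<close>. The
  constant is \<open>2 * A\<close> for averages, doubled by the ratio of lengths.\<close>

lemma dual_mass_doubling:
  assumes cd: "a \<le> c" "c < d" "d \<le> b" and half: "b - a = 2 * (d - c)"
  shows "dual_mass u a b \<le> 4 * A * dual_mass u c d"
proof -
  have ab: "a < b" using cd by simp
  define w where "w = Y a b *v u"
  define p where "p = u \<bullet> (Y a b *v u)"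
  have A: "1 \<le> A" by (rule A_ge_1)
  have 1: "w \<bullet> (X a b *v w) \<le> A * p"
    using A2_pairD(4)[OF A2_pair_averages[OF ab], of w] inv_form_solution[OF posdef_Y[OF ab], of u w]
    by (simp add: w_def p_def)
  have "(d - c) * (w \<bullet> (X c d *v w)) = (LINT x:{c..d}|lebesgue. w \<bullet> (W x *v w))"
    by (rule set_integral_matrix_form[OF loc_W cd(2), symmetric])
  also have "\<dots> \<le> (LINT x:{a..b}|lebesgue. w \<bullet> (W x *v w))"
    unfolding set_lebesgue_integral_def
  proof (rule integral_mono_AE)
    show "AE x in lebesgue. indicator {c..d} x *\<^sub>R (w \<bullet> (W x *v w)) \<le> indicator {a..b} x *\<^sub>R (w \<bullet> (W x *v w))"
      using AE_posdef
    proof eventually_elim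
      case (elim x)
      then show ?case using cd posdef_nonneg[OF elim, of w] by (auto simp: indicator_def)
    qed
  qed (use set_integrable_matrix_form[OF loc_W] in \<open>simp_all add: set_integrable_def\<close>)
  also have "\<dots> = (b - a) * (w \<bullet> (X a b *v w))"
    by (rule set_integral_matrix_form[OF loc_W ab])
  finally have "(d - c) * (w \<bullet> (X c d *v w)) \<le> (d - c) * (2 * (w \<bullet> (X a b *v w)))"
    by (simp only: half mult.assoc mult.left_commute)
  then have 2: "w \<bullet> (X c d *v w) \<le> 2 * (w \<bullet> (X a b *v w))"
    using cd by simp
  \<comment> \<open>This maximises \<open>2 * s * p - s * s * (2 * (A * p))\<close>, with value
    \<open>p / (2 * A)\<close>.\<close>
  define s where "s = 1 / (2 * A)"
  have "2 * (u \<bullet> (s *\<^sub>R w)) \<le> (s *\<^sub>R w) \<bullet> (X c d *v (s *\<^sub>R w)) + u \<bullet> (Y c d *v u)"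
    by (rule average_young[OF cd(2)])
  then have "2 * s * p \<le> s * s * (w \<bullet> (X c d *v w)) + u \<bullet> (Y c d *v u)"
    by (simp add: mv_scaleR_right p_def w_def)
  also have "s * s * (w \<bullet> (X c d *v w)) \<le> s * s * (2 * (A * p))"
    using 1 2 by (intro mult_left_mono) auto
  also have "s * s * (2 * (A * p)) = s * p" using A by (simp add: s_def)
  finally have "s * p \<le> u \<bullet> (Y c d *v u)" by (simp add: mult.commute)
  then have "p \<le> 2 * A * (u \<bullet> (Y c d *v u))" using A by (simp add: s_def field_simps)
  then have "(b - a) * p \<le> (b - a) * (2 * A * (u \<bullet> (Y c d *v u)))"
    using ab by (intro mult_left_mono) auto
  moreover have "(b - a) * (2 * A * z) = 4 * A * ((d - c) * z)" for z
    unfolding half by (simp add: algebra_simps)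
  ultimately show ?thesis
    by (simp only: dual_mass_eq[OF ab] dual_mass_eq[OF cd(2)] p_def)
qed

definition \<theta> :: real where
  "\<theta> = 1 - 1 / (4 * A)"

lemma \<theta>_bounds: "0 < \<theta>" "\<theta> < 1"
proof -
  have "1 / (4 * A) \<le> 1 / 4" using A_ge_1 by (intro divide_left_mono) auto
  then show "0 < \<theta>" by (simp add: \<theta>_def)
  show "\<theta> < 1" using A_ge_1 by (simp add: \<theta>_def)
qed

text \<open>Doubling is applied to the complementary half, which therefore keeps at least the
  fraction \<open>1 / (4 * A)\<close> of the mass.\<close>

lemma dual_mass_half:
  assumes ab: "a < b"
  shows "dual_mass u a ((a + b) / 2) \<le> \<theta> * dual_mass u a b"
    "dual_mass u ((a + b) / 2) b \<le> \<theta> * dual_mass u a b"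
proof -
  have sum: "dual_mass u a b = dual_mass u a ((a + b) / 2) + dual_mass u ((a + b) / 2) b"
    using ab by (intro dual_mass_combine) auto
  have arith: "x \<le> \<theta> * v" if "v = x + y" "v \<le> 4 * A * y" for x y v
  proof -
    have "v / (4 * A) \<le> y" using that(2) A_ge_1 by (simp add: field_simps)
    then show ?thesis using that(1) by (simp add: \<theta>_def left_diff_distrib)
  qed
  show "dual_mass u a ((a + b) / 2) \<le> \<theta> * dual_mass u a b"
    by (rule arith[OF sum]) (rule dual_mass_doubling, use ab in \<open>auto simp: field_simps\<close>)
  show "dual_mass u ((a + b) / 2) b \<le> \<theta> * dual_mass u a b"
    by (rule arith[OF sum[unfolded add.commute[of "dual_mass u a _"]]])
      (rule dual_mass_doubling, use ab in \<open>auto simp: field_simps\<close>)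
qed

end

section \<open>Exhaustion of the two half-lines\<close>

context A2_weight_function
begin

lemma dual_mass_dilate:
  assumes r: "0 < r"
  shows "dual_mass u \<alpha> (\<alpha> + r * 2 ^ k) \<le> \<theta> ^ m * dual_mass u \<alpha> (\<alpha> + r * 2 ^ (m + k))"
    "dual_mass u (\<alpha> - r * 2 ^ k) \<alpha> \<le> \<theta> ^ m * dual_mass u (\<alpha> - r * 2 ^ (m + k)) \<alpha>"
proof (induction m)
  case (Suc m)
  have mid: "(\<alpha> + (\<alpha> + r * 2 ^ (Suc m + k))) / 2 = \<alpha> + r * 2 ^ (m + k)"
    "((\<alpha> - r * 2 ^ (Suc m + k)) + \<alpha>) / 2 = \<alpha> - r * 2 ^ (m + k)"
    by (simp_all add: field_simps)
  note \<theta>m = mult_left_mono[OF _ zero_le_power[OF less_imp_le[OF \<theta>_bounds(1)], of m]]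
  have "dual_mass u \<alpha> (\<alpha> + r * 2 ^ (m + k)) \<le> \<theta> * dual_mass u \<alpha> (\<alpha> + r * 2 ^ (Suc m + k))"
    using dual_mass_half(1)[of \<alpha> "\<alpha> + r * 2 ^ (Suc m + k)" u] r by (simp only: mid) simp
  from order_trans[OF Suc(1) \<theta>m[OF this]]
  show "dual_mass u \<alpha> (\<alpha> + r * 2 ^ k) \<le> \<theta> ^ Suc m * dual_mass u \<alpha> (\<alpha> + r * 2 ^ (Suc m + k))"
    by (simp only: power_Suc2 mult.assoc)
  have "dual_mass u (\<alpha> - r * 2 ^ (m + k)) \<alpha> \<le> \<theta> * dual_mass u (\<alpha> - r * 2 ^ (Suc m + k)) \<alpha>"
    using dual_mass_half(2)[of "\<alpha> - r * 2 ^ (Suc m + k)" \<alpha> u] r by (simp only: mid) simp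
  from order_trans[OF Suc(2) \<theta>m[OF this]]
  show "dual_mass u (\<alpha> - r * 2 ^ k) \<alpha> \<le> \<theta> ^ Suc m * dual_mass u (\<alpha> - r * 2 ^ (Suc m + k)) \<alpha>"
    by (simp only: power_Suc2 mult.assoc)
qed simp_all

lemma coarse_dilate_le:
  assumes r: "0 < r"
  shows "coarse \<alpha> (\<alpha> + r * 2 ^ (m + k)) \<le> A * (2 * (total_energy \<alpha> (\<alpha> + r * 2 ^ (m + k)) - total_energy \<alpha> (\<alpha> + r * 2 ^ k))
      + 2 * \<theta> ^ m * total_energy \<alpha> (\<alpha> + r * 2 ^ k))"
    "coarse (\<alpha> - r * 2 ^ (m + k)) \<alpha> \<le> A * (2 * (total_energy (\<alpha> - r * 2 ^ (m + k)) \<alpha> - total_energy (\<alpha> - r * 2 ^ k) \<alpha>)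
      + 2 * \<theta> ^ m * total_energy (\<alpha> - r * 2 ^ k) \<alpha>)"
proof -
  have "(2::real) ^ k \<le> 2 ^ (m + k)" by (intro power_increasing) auto
  then have le: "r * 2 ^ k \<le> r * 2 ^ (m + k)" using r by simp
  have pos: "0 < r * 2 ^ k" "0 < r * 2 ^ (m + k)" "0 < \<theta> ^ m"
    using r \<theta>_bounds by auto
  show "coarse \<alpha> (\<alpha> + r * 2 ^ (m + k)) \<le> A * (2 * (total_energy \<alpha> (\<alpha> + r * 2 ^ (m + k)) - total_energy \<alpha> (\<alpha> + r * 2 ^ k))
      + 2 * \<theta> ^ m * total_energy \<alpha> (\<alpha> + r * 2 ^ k))"
    by (rule coarse_le) (use le pos dual_mass_dilate(1)[OF r] in auto)
  show "coarse (\<alpha> - r * 2 ^ (m + k)) \<alpha> \<le> A * (2 * (total_energy (\<alpha> - r * 2 ^ (m + k)) \<alpha> - total_energy (\<alpha> - r * 2 ^ k) \<alpha>)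
      + 2 * \<theta> ^ m * total_energy (\<alpha> - r * 2 ^ k) \<alpha>)"
    by (rule coarse_le) (use le pos dual_mass_dilate(2)[OF r] in auto)
qed

lemma total_energy_tendsto:
  assumes r: "0 < r"
  shows "(\<lambda>k. total_energy (\<alpha> - r * 2 ^ k) (\<alpha> + r * 2 ^ k)) \<longlonglongrightarrow> integral\<^sup>L lebesgue energy"
  unfolding total_energy_def set_lebesgue_integral_def
proof (rule integral_dominated_convergence)
  show "integrable lebesgue energy" by (rule energy_integrable)
  then show m: "energy \<in> borel_measurable lebesgue" by (rule borel_measurable_integrable)
  show "(\<lambda>x. indicator {\<alpha> - r * 2 ^ k..\<alpha> + r * 2 ^ k} x *\<^sub>R energy x) \<in> borel_measurable lebesgue" for k
    by (intro borel_measurable_scaleR borel_measurable_indicator m) auto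
  show "AE x in lebesgue. norm (indicator {\<alpha> - r * 2 ^ k..\<alpha> + r * 2 ^ k} x *\<^sub>R energy x) \<le> energy x" for k
    using AE_energy_nonneg by eventually_elim (auto simp: indicator_def)
  show "AE x in lebesgue. (\<lambda>k. indicator {\<alpha> - r * 2 ^ k..\<alpha> + r * 2 ^ k} x *\<^sub>R energy x) \<longlonglongrightarrow> energy x"
  proof (rule AE_I2)
    fix x
    obtain k0 where "\<bar>x - \<alpha>\<bar> / r < 2 ^ k0" using real_arch_pow[of 2 "\<bar>x - \<alpha>\<bar> / r"] by auto
    then have k0: "\<bar>x - \<alpha>\<bar> < r * 2 ^ k0" using r by (simp add: field_simps)
    have "\<forall>\<^sub>F k in sequentially. indicator {\<alpha> - r * 2 ^ k..\<alpha> + r * 2 ^ k} x *\<^sub>R energy x = energy x"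
      using eventually_ge_at_top[of k0]
    proof eventually_elim
      case (elim k)
      then have "r * 2 ^ k0 \<le> r * 2 ^ k" using r by (intro mult_left_mono power_increasing) auto
      then have "x \<in> {\<alpha> - r * 2 ^ k..\<alpha> + r * 2 ^ k}" using k0 by auto
      then show ?case by simp
    qed
    then show "(\<lambda>k. indicator {\<alpha> - r * 2 ^ k..\<alpha> + r * 2 ^ k} x *\<^sub>R energy x) \<longlonglongrightarrow> energy x"
      by (rule tendsto_eventually)
  qed
qed

text \<open>The point \<open>\<alpha>\<close> is interior to no grid interval, so the line is
  exhausted by pairs of intervals adjacent to it, each side with its own mean term.\<close>

lemma energy_integral_le:
  assumes r: "0 < r"
    and S: "\<And>k n n'. node_sum haar_term n \<alpha> (\<alpha> + r * 2 ^ k) + node_sum haar_term n' (\<alpha> - r * 2 ^ k) \<alpha> \<le> S"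
  shows "integral\<^sup>L lebesgue energy \<le> 2 * C * S"
proof -
  define T where "T k = total_energy (\<alpha> - r * 2 ^ k) (\<alpha> + r * 2 ^ k)" for k :: nat
  define TR where "TR k = total_energy \<alpha> (\<alpha> + r * 2 ^ k)" for k :: nat
  define TL where "TL k = total_energy (\<alpha> - r * 2 ^ k) \<alpha>" for k :: nat
  let ?E = "integral\<^sup>L lebesgue energy"
  have T: "T k = TR k + TL k" for k
    using r by (simp add: T_def TR_def TL_def total_energy_combine[of "\<alpha> - r * 2 ^ k" \<alpha> "\<alpha> + r * 2 ^ k"])
  have lim: "T \<longlonglongrightarrow> ?E" unfolding T_def by (rule total_energy_tendsto[OF r])
  have split: "T k \<le> C * (coarse \<alpha> (\<alpha> + r * 2 ^ k) + coarse (\<alpha> - r * 2 ^ k) \<alpha>) + 2 * C * S" for k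
  proof -
    let ?N = "\<lambda>n. node_sum haar_term n \<alpha> (\<alpha> + r * 2 ^ k)"
    \<comment> \<open>The depths on the two sides vary independently, so if \<open>q\<close> is the
      supremum on the right, \<open>S - q\<close> bounds every sum on the left. Adding the two
      estimates then yields \<open>S\<close> once instead of twice.\<close>
    define q where "q = (SUP n. ?N n)"
    have bdd: "bdd_above (range ?N)"
      using S[where n' = 0] by (auto intro!: bdd_aboveI[of _ S])
    have q1: "?N n \<le> q" for n unfolding q_def by (rule cSUP_upper[OF _ bdd]) simp
    have q2: "node_sum haar_term n' (\<alpha> - r * 2 ^ k) \<alpha> \<le> S - q" for n'
    proof -
      have "q \<le> S - node_sum haar_term n' (\<alpha> - r * 2 ^ k) \<alpha>"
        unfolding q_def using S by (intro cSUP_least) (auto simp: le_diff_eq)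
      then show ?thesis by simp
    qed
    have "TR k \<le> C * coarse \<alpha> (\<alpha> + r * 2 ^ k) + 2 * C * q"
      unfolding TR_def by (rule energy_le_coarse[OF _ q1]) (use r in simp)
    moreover have "TL k \<le> C * coarse (\<alpha> - r * 2 ^ k) \<alpha> + 2 * C * (S - q)"
      unfolding TL_def by (rule energy_le_coarse[OF _ q2]) (use r in simp)
    ultimately show ?thesis unfolding T by (simp add: algebra_simps)
  qed
  have bound: "T (m + k) \<le> C * (A * (2 * (T (m + k) - T k) + 2 * \<theta> ^ m * T k)) + 2 * C * S" for m k
  proof -
    have "coarse \<alpha> (\<alpha> + r * 2 ^ (m + k)) + coarse (\<alpha> - r * 2 ^ (m + k)) \<alpha>
        \<le> A * (2 * (T (m + k) - T k) + 2 * \<theta> ^ m * T k)"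
      using add_mono[OF coarse_dilate_le[OF r, of \<alpha> m k]]
      unfolding T TR_def TL_def by (simp add: algebra_simps)
    from mult_left_mono[OF this, of C] split[of "m + k"] C_pos show ?thesis by linarith
  qed
  have \<theta>lim: "(\<lambda>m. \<theta> ^ m) \<longlonglongrightarrow> 0" using \<theta>_bounds by (intro LIMSEQ_realpow_zero) auto
  \<comment> \<open>The limits are taken in this order: first \<open>m\<close> grows with
    \<open>k\<close> fixed and removes \<open>\<theta> ^ m\<close>, then \<open>k\<close> grows and
    removes the energy tail \<open>?E - T k\<close>.\<close>
  have "?E \<le> C * (A * (2 * (?E - T k) + 2 * 0 * T k)) + 2 * C * S" for k
  proof (rule LIMSEQ_le)
    show "(\<lambda>m. T (m + k)) \<longlonglongrightarrow> ?E" by (rule LIMSEQ_ignore_initial_segment[OF lim])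
    then show "(\<lambda>m. C * (A * (2 * (T (m + k) - T k) + 2 * \<theta> ^ m * T k)) + 2 * C * S)
        \<longlonglongrightarrow> C * (A * (2 * (?E - T k) + 2 * 0 * T k)) + 2 * C * S"
      by (intro tendsto_intros \<theta>lim)
  qed (use bound in blast)
  moreover have "(\<lambda>k. C * (A * (2 * (?E - T k) + 2 * 0 * T k)) + 2 * C * S)
      \<longlonglongrightarrow> C * (A * (2 * (?E - ?E) + 2 * 0 * ?E)) + 2 * C * S"
    by (intro tendsto_intros lim)
  ultimately have "?E \<le> C * (A * (2 * (?E - ?E) + 2 * 0 * ?E)) + 2 * C * S"
    by (intro LIMSEQ_le_const) auto
  then show ?thesis by simp
qed

end

section \<open>The dyadic grid\<close>

primrec nodes :: "nat \<Rightarrow> real \<Rightarrow> real \<Rightarrow> (real \<times> real) set" where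
  "nodes 0 a b = {}"
| "nodes (Suc n) a b = insert (a, b) (nodes n a ((a + b) / 2) \<union> nodes n ((a + b) / 2) b)"

lemma finite_nodes: "finite (nodes n a b)"
  by (induction n arbitrary: a b) auto

lemma nodes_bounds: "(c, d) \<in> nodes n a b \<Longrightarrow> a < b \<Longrightarrow> a \<le> c \<and> c < d \<and> d \<le> b"
proof (induction n arbitrary: a b)
  case (Suc n)
  define m where "m = (a + b) / 2"
  have m: "a < m" "m < b" using Suc.prems by (auto simp: m_def)
  show ?case
    using Suc.prems(1) Suc.IH[OF _ m(1)] Suc.IH[OF _ m(2)] m by (fastforce simp: m_def[symmetric])
qed simp

text \<open>A sum over a set counts each interval once, so the nodes must be distinct: those of a
  half lie inside it and have positive length, hence differ from the root and from those of the
  other half.\<close>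

lemma node_sum_eq: "a < b \<Longrightarrow> node_sum \<phi> n a b = (\<Sum>(c, d)\<in>nodes n a b. \<phi> c d)"
proof (induction n arbitrary: a b)
  case (Suc n)
  define m where "m = (a + b) / 2"
  have m: "a < m" "m < b" using Suc.prems by (auto simp: m_def)
  have 1: "(a, b) \<notin> nodes n a m \<union> nodes n m b"
    using nodes_bounds[of a b n a m] nodes_bounds[of a b n m b] m by auto
  have 2: "nodes n a m \<inter> nodes n m b = {}"
    using nodes_bounds[of _ _ n a m] nodes_bounds[of _ _ n m b] m by fastforce
  show ?case
    using Suc.IH[OF m(1)] Suc.IH[OF m(2)] 1 2
    by (simp add: m_def[symmetric] finite_nodes sum.union_disjoint)
qed simp

lemma nodes_subset_grid: "(a, b) \<in> dyadic_grid \<alpha> r \<Longrightarrow> nodes n a b \<subseteq> dyadic_grid \<alpha> r"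
proof (induction n arbitrary: a b)
  case (Suc n)
  from Suc.prems obtain j k where jk: "a = \<alpha> + r * (of_int k * 2 powi j)" "b = \<alpha> + r * ((of_int k + 1) * 2 powi j)"
    by (auto simp: dyadic_grid_def)
  \<comment> \<open>The halves of the interval with index \<open>k\<close> have indices
    \<open>2 * k\<close> and \<open>2 * k + 1\<close> one generation below.\<close>
  define p :: real where "p = 2 powi (j - 1)"
  have p: "2 powi j = 2 * p"
    using power_int_add[of "2::real" "j - 1" 1] by (simp add: p_def)
  have "a = \<alpha> + r * (of_int (2 * k) * p)" "(a + b) / 2 = \<alpha> + r * ((of_int (2 * k) + 1) * p)"
    by (simp_all add: jk p field_simps)
  then have l: "(a, (a + b) / 2) \<in> dyadic_grid \<alpha> r"
    unfolding dyadic_grid_def p_def by blast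
  have "(a + b) / 2 = \<alpha> + r * (of_int (2 * k + 1) * p)" "b = \<alpha> + r * ((of_int (2 * k + 1) + 1) * p)"
    by (simp_all add: jk p field_simps)
  then have u: "((a + b) / 2, b) \<in> dyadic_grid \<alpha> r"
    unfolding dyadic_grid_def p_def by blast
  show ?case using Suc.IH[OF l] Suc.IH[OF u] Suc.prems by simp
qed simp

lemma origin_intervals_in_grid:
  "(\<alpha>, \<alpha> + r * 2 ^ k) \<in> dyadic_grid \<alpha> r" "(\<alpha> - r * 2 ^ k, \<alpha>) \<in> dyadic_grid \<alpha> r"
proof -
  have "\<alpha> = \<alpha> + r * (of_int 0 * 2 powi (int k))" "\<alpha> + r * 2 ^ k = \<alpha> + r * ((of_int 0 + 1) * 2 powi (int k))"
    by simp_all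
  then show "(\<alpha>, \<alpha> + r * 2 ^ k) \<in> dyadic_grid \<alpha> r"
    unfolding dyadic_grid_def by blast
  have "\<alpha> - r * 2 ^ k = \<alpha> + r * (of_int (- 1) * 2 powi (int k))" "\<alpha> = \<alpha> + r * ((of_int (- 1) + 1) * 2 powi (int k))"
    by simp_all
  then show "(\<alpha> - r * 2 ^ k, \<alpha>) \<in> dyadic_grid \<alpha> r"
    unfolding dyadic_grid_def by blast
qed

section \<open>Comparison with the square function\<close>

context A2_weight_function
begin

lemma node_sums_le_square_function:
  assumes r: "0 < r"
  shows "ennreal (node_sum haar_term n \<alpha> (\<alpha> + r * 2 ^ k) + node_sum haar_term n' (\<alpha> - r * 2 ^ k) \<alpha>)
    \<le> square_function_norm_sq \<alpha> r W f"
proof -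
  have ab: "\<alpha> < \<alpha> + r * 2 ^ k" "\<alpha> - r * 2 ^ k < \<alpha>" using r by auto
  let ?L = "nodes n' (\<alpha> - r * 2 ^ k) \<alpha>" and ?R = "nodes n \<alpha> (\<alpha> + r * 2 ^ k)"
  have pos: "c < d" if "(c, d) \<in> ?R \<union> ?L" for c d
    using that nodes_bounds[OF _ ab(1)] nodes_bounds[OF _ ab(2)] by blast
  have disj: "?R \<inter> ?L = {}"
    using nodes_bounds[OF _ ab(1), of _ _ n] nodes_bounds[OF _ ab(2), of _ _ n'] by fastforce
  have "node_sum haar_term n \<alpha> (\<alpha> + r * 2 ^ k) + node_sum haar_term n' (\<alpha> - r * 2 ^ k) \<alpha>
      = (\<Sum>(c, d)\<in>?R \<union> ?L. haar_term c d)"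
    using disj by (simp add: node_sum_eq[OF ab(1)] node_sum_eq[OF ab(2)] sum.union_disjoint finite_nodes)
  also have "ennreal \<dots> = (\<Sum>(c, d)\<in>?R \<union> ?L. ennreal (haar_term c d))"
    by (subst sum_ennreal[symmetric]) (use pos in \<open>auto simp: case_prod_unfold haar_term_nonneg\<close>)
  also have "\<dots> = (\<Sum>(c, d)\<in>?R \<union> ?L. ennreal (Re (cinner (X c d *v haar_coeff f c d) (haar_coeff f c d))))"
    by (intro sum.cong refl) (use pos in \<open>auto simp: haar_term_eq\<close>)
  also have "\<dots> \<le> square_function_norm_sq \<alpha> r W f"
    unfolding square_function_norm_sq_def
  proof (subst nonneg_infsum_complete)
    have "?R \<union> ?L \<subseteq> dyadic_grid \<alpha> r"
      by (intro Un_least nodes_subset_grid origin_intervals_in_grid)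
    then show "(\<Sum>(c, d)\<in>?R \<union> ?L. ennreal (Re (cinner (X c d *v haar_coeff f c d) (haar_coeff f c d))))
        \<le> (SUP N\<in>{N. finite N \<and> N \<subseteq> dyadic_grid \<alpha> r}.
            \<Sum>(c, d)\<in>N. ennreal (Re (cinner (X c d *v haar_coeff f c d) (haar_coeff f c d))))"
      by (intro SUP_upper) (simp add: finite_nodes)
  qed auto
  finally show ?thesis .
qed

lemma weighted_norm_le_square_function:
  assumes r: "0 < r"
  shows "ennreal (weighted_L2_norm_sq W f) \<le> ennreal (2 * C) * square_function_norm_sq \<alpha> r W f"
proof (cases "square_function_norm_sq \<alpha> r W f")
  case (real S)
  have "integral\<^sup>L lebesgue energy \<le> 2 * C * S"
    by (rule energy_integral_le[OF r])
      (use node_sums_le_square_function[OF r, of _ \<alpha>] real in \<open>simp add: ennreal_le_iff\<close>)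
  moreover have "weighted_L2_norm_sq W f = integral\<^sup>L lebesgue energy"
    by (simp add: weighted_L2_norm_sq_def energy_eq)
  ultimately show ?thesis
    using real C_pos by (simp add: ennreal_mult[symmetric] ennreal_leI)
next
  \<comment> \<open>Positivity of \<open>C\<close> matters here, since 0 times infinity is 0 in
    \<open>ennreal\<close>.\<close>
  case top
  then show ?thesis using C_pos by (simp add: ennreal_mult_top)
qed

end

theorem theorem3p2:
  "\<exists>C::real. C > 0 \<and>
     (\<forall>(W :: real \<Rightarrow> complex ^ 'n ^ 'n) (\<alpha> :: real) (r :: real) (f :: real \<Rightarrow> complex ^ 'n).
        matrix_weight W \<longrightarrow> matrix_A2 W \<longrightarrow> r > 0 \<longrightarrow> f \<in> weighted_L2 W \<longrightarrow>
        ennreal (weighted_L2_norm_sq W f)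
          \<le> ennreal (C * A2_const W * (1 + ln (A2_const W))) * square_function_norm_sq \<alpha> r W f)"
proof (intro exI[of _ "66 * real CARD('n)"] conjI allI impI)
  show "0 < 66 * real CARD('n)" by simp
  fix W :: "real \<Rightarrow> complex ^ 'n ^ 'n" and \<alpha> r :: real and f :: "real \<Rightarrow> complex ^ 'n"
  assume "matrix_weight W" "matrix_A2 W" and r: "0 < r" and "f \<in> weighted_L2 W"
  then interpret A2_weight_function W f by unfold_locales
  \<comment> \<open>This absorbs the summand 2 of \<open>2 * C\<close>, whose other summand has
    coefficient 64; hence the constant 66.\<close>
  have "1 \<le> real CARD('n) * A * (1 + ln A)"
  proof -
    have "1 * 1 * 1 \<le> real CARD('n) * A * (1 + ln A)"
      using A_ge_1 by (intro mult_mono) (auto simp: Suc_le_eq)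
    then show ?thesis by simp
  qed
  moreover have "2 * C = 2 + 64 * (real CARD('n) * A * (1 + ln A))"
    by (simp add: C_def mult_ac)
  ultimately have "2 * C \<le> 66 * (real CARD('n) * A * (1 + ln A))"
    by linarith
  also have "\<dots> = 66 * real CARD('n) * A2_const W * (1 + ln (A2_const W))"
    by (simp only: A_def mult.assoc)
  finally have "2 * C \<le> 66 * real CARD('n) * A2_const W * (1 + ln (A2_const W))" .
  then have "ennreal (2 * C) * square_function_norm_sq \<alpha> r W f
      \<le> ennreal (66 * real CARD('n) * A2_const W * (1 + ln (A2_const W))) * square_function_norm_sq \<alpha> r W f"
    by (intro mult_right_mono ennreal_leI) auto
  with weighted_norm_le_square_function[OF r]
  show "ennreal (weighted_L2_norm_sq W f)
      \<le> ennreal (66 * real CARD('n) * A2_const W * (1 + ln (A2_const W))) * square_function_norm_sq \<alpha> r W f"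
    by (rule order_trans)
qed

end
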